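(* The minimal exponential growth rate of the restricted wreath product $\mathbb{Z}\wr\mathbb{Z}=\langle a,t\mid[t^kat^{-k},a]=1\ (k=1,2,\ldots)\rangle$ is realized on the generating set $\{a,t\}$, and $$\Omega(\mathbb{Z}\wr\mathbb{Z})=\omega(\mathbb{Z}\wr\mathbb{Z},\{a,t\})=1+\sqrt2.$$
   Context: For a finitely generated group $G$ and a finite generating set $S$ of $G$, let $\ell_{G,S}(g)$ be the minimal length of a word in $S\cup S^{-1}$ representing $g\in G$, let $F_{G,S}(n)$ be the number of $g\in G$ with $\ell_{G,S}(g)\le n$, and define the exponential growth rate $\omega(G,S)=\lim_{n\to\infty}F_{G,S}(n)^{1/n}$ (the limit exists). The minimal exponential growth rate is $\Omega(G)=\inf_S\omega(G,S)$, the infimum over all finite generating sets $S$ of $G$. *)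

theory Defs
  imports Complex_Main "HOL-Algebra.Product_Groups"
begin

section \<open>Words and presentations\<close>

text \<open>The letter \<open>(x, True)\<close> stands for \<open>x\<close> and \<open>(x, False)\<close> for its formal inverse.\<close>

type_synonym 'a gword = "('a \<times> bool) list"

definition word_value :: "('a, 'm) monoid_scheme \<Rightarrow> 'a gword \<Rightarrow> 'a" where
  "word_value G w =
     foldr (\<lambda>(x, b) g. (if b then x else inv\<^bsub>G\<^esub> x) \<otimes>\<^bsub>G\<^esub> g) w \<one>\<^bsub>G\<^esub>"

definition word_inv :: "'a gword \<Rightarrow> 'a gword" where
  "word_inv w = rev (map (\<lambda>(x, b). (x, \<not> b)) w)"

definition word_commutator :: "'a gword \<Rightarrow> 'a gword \<Rightarrow> 'a gword" where
  "word_commutator u v = u @ v @ word_inv u @ word_inv v"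

text \<open>Equality in the group \<open>\<langle>X | R\<rangle>\<close>, i.e. in the quotient of the free group on \<open>X\<close> by the
  normal closure of the relators \<open>R\<close>.\<close>

inductive word_equiv :: "'a set \<Rightarrow> 'a gword set \<Rightarrow> 'a gword \<Rightarrow> 'a gword \<Rightarrow> bool"
  for X :: "'a set" and R :: "'a gword set" where
  word_equiv_refl: "word_equiv X R u u"
| word_equiv_sym: "word_equiv X R u v \<Longrightarrow> word_equiv X R v u"
| word_equiv_trans: "word_equiv X R u v \<Longrightarrow> word_equiv X R v w \<Longrightarrow> word_equiv X R u w"
| word_equiv_cancel: "x \<in> X \<Longrightarrow> word_equiv X R (u @ [(x, b), (x, \<not> b)] @ v) (u @ v)"
| word_equiv_relator: "r \<in> R \<Longrightarrow> word_equiv X R (u @ r @ v) (u @ v)"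

text \<open>The inclusion of \<open>X\<close> into \<open>G\<close> induces an isomorphism from \<open>\<langle>X | R\<rangle>\<close> onto \<open>G\<close>.\<close>

definition has_presentation :: "('a, 'm) monoid_scheme \<Rightarrow> 'a set \<Rightarrow> 'a gword set \<Rightarrow> bool" where
  "has_presentation G X R \<longleftrightarrow>
     X \<subseteq> carrier G \<and> R \<subseteq> lists (X \<times> UNIV) \<and> generate G X = carrier G \<and>
     (\<forall>w \<in> lists (X \<times> UNIV). word_value G w = \<one>\<^bsub>G\<^esub> \<longleftrightarrow> word_equiv X R w [])"

section \<open>Exponential growth rates\<close>

definition finite_generating_set :: "('a, 'm) monoid_scheme \<Rightarrow> 'a set \<Rightarrow> bool" where
  "finite_generating_set G S \<longleftrightarrow> finite S \<and> S \<subseteq> carrier G \<and> generate G S = carrier G"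

definition word_length :: "('a, 'm) monoid_scheme \<Rightarrow> 'a set \<Rightarrow> 'a \<Rightarrow> nat" where
  "word_length G S g =
     (LEAST n. \<exists>w \<in> lists (S \<times> UNIV). length w = n \<and> word_value G w = g)"

definition growth_function :: "('a, 'm) monoid_scheme \<Rightarrow> 'a set \<Rightarrow> nat \<Rightarrow> nat" where
  "growth_function G S n = card {g \<in> carrier G. word_length G S g \<le> n}"

definition growth_rate :: "('a, 'm) monoid_scheme \<Rightarrow> 'a set \<Rightarrow> real" where
  "growth_rate G S = lim (\<lambda>n. root n (real (growth_function G S n)))"

definition minimal_growth_rate :: "('a, 'm) monoid_scheme \<Rightarrow> real" where
  "minimal_growth_rate G = (INF S \<in> {S. finite_generating_set G S}. growth_rate G S)"

section \<open>Restricted wreath products\<close>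

text \<open>The semidirect product of the direct sum of copies of \<open>A\<close> indexed by \<open>B\<close> with \<open>B\<close>,
  where \<open>b\<close> sends a function \<open>g\<close> to \<open>x \<mapsto> g (b\<inverse> x)\<close>.\<close>

definition restricted_wreath ::
    "('a, 'm) monoid_scheme \<Rightarrow> ('b, 'n) monoid_scheme \<Rightarrow> (('b \<Rightarrow> 'a) \<times> 'b) monoid" where
  "restricted_wreath A B =
     \<lparr>carrier = carrier (sum_group (carrier B) (\<lambda>_. A)) \<times> carrier B,
      monoid.mult = (\<lambda>(f, b) (g, c).
        (f \<otimes>\<^bsub>sum_group (carrier B) (\<lambda>_. A)\<^esub> (\<lambda>x\<in>carrier B. g (inv\<^bsub>B\<^esub> b \<otimes>\<^bsub>B\<^esub> x)),
         b \<otimes>\<^bsub>B\<^esub> c)),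
      one = (\<one>\<^bsub>sum_group (carrier B) (\<lambda>_. A)\<^esub>, \<one>\<^bsub>B\<^esub>)\<rparr>"

abbreviation Z_wr_Z :: "((int \<Rightarrow> int) \<times> int) monoid" where
  "Z_wr_Z \<equiv> restricted_wreath integer_group integer_group"

definition gen_a :: "(int \<Rightarrow> int) \<times> int" where
  "gen_a = ((\<lambda>i. if i = 0 then 1 else 0), 0)"

definition gen_t :: "(int \<Rightarrow> int) \<times> int" where
  "gen_t = ((\<lambda>i. 0), 1)"

text \<open>The relator \<open>[t\<^sup>k a t\<^sup>-\<^sup>k, a]\<close>.\<close>

definition Z_wr_Z_relator :: "nat \<Rightarrow> ((int \<Rightarrow> int) \<times> int) gword" where
  "Z_wr_Z_relator k =
     word_commutator
       (replicate k (gen_t, True) @ [(gen_a, True)] @ replicate k (gen_t, False))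
       [(gen_a, True)]"

section \<open>Existence of the growth rate\<close>

lemma (in group) word_value_closed:
  assumes "S \<subseteq> carrier G" "w \<in> lists (S \<times> UNIV)"
  shows "word_value G w \<in> carrier G"
  using assms(2) by (induction w) (use assms(1) in \<open>auto simp: word_value_def\<close>)

lemma (in group) word_value_append:
  assumes "S \<subseteq> carrier G" "u \<in> lists (S \<times> UNIV)" "v \<in> lists (S \<times> UNIV)"
  shows "word_value G (u @ v) = word_value G u \<otimes> word_value G v"
  using assms(2)
proof (induction u)
  case Nil
  then show ?case using word_value_closed[OF assms(1,3)] by (simp add: word_value_def)
next
  case (Cons p u)
  obtain x b where p: "p = (x, b)" by force
  have x: "x \<in> carrier G" and u: "u \<in> lists (S \<times> UNIV)" using Cons.hyps p assms(1) by auto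
  have "word_value G u \<in> carrier G" "word_value G v \<in> carrier G"
    using word_value_closed[OF assms(1)] u assms(3) by auto
  moreover have "word_value G (p # w) = (if b then x else inv x) \<otimes> word_value G w" for w
    by (simp add: word_value_def p)
  ultimately show ?case using Cons.IH x by (simp add: m_assoc)
qed

lemma (in group) generate_imp_word:
  assumes "S \<subseteq> carrier G" "g \<in> generate G S"
  shows "\<exists>w \<in> lists (S \<times> UNIV). word_value G w = g"
  using assms(2)
proof induction
  case one
  show ?case by (rule bexI[of _ "[]"]) (auto simp: word_value_def)
next
  case (incl h)
  then show ?case using assms(1) by (intro bexI[of _ "[(h, True)]"]) (auto simp: word_value_def)
next
  case (inv h)
  then show ?case using assms(1) by (intro bexI[of _ "[(h, False)]"]) (auto simp: word_value_def)
next
  case (eng h1 h2)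
  then obtain u v where "u \<in> lists (S \<times> UNIV)" "word_value G u = h1"
    "v \<in> lists (S \<times> UNIV)" "word_value G v = h2" by blast
  then show ?case using word_value_append[OF assms(1)]
    by (intro bexI[of _ "u @ v"]) auto
qed

lemma (in group) word_value_in_generate:
  assumes "w \<in> lists (S \<times> UNIV)"
  shows "word_value G w \<in> generate G S"
  using assms by (induction w)
    (auto simp: word_value_def intro!: generate.eng intro: generate.incl generate.inv generate.one)

lemma (in group) word_length_le_iff:
  assumes "finite_generating_set G S" "g \<in> carrier G"
  shows "word_length G S g \<le> n \<longleftrightarrow>
    (\<exists>w \<in> lists (S \<times> UNIV). length w \<le> n \<and> word_value G w = g)"
proof
  have "\<exists>w \<in> lists (S \<times> UNIV). word_value G w = g"
    using assms generate_imp_word unfolding finite_generating_set_def by blast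
  then have "\<exists>m. \<exists>w \<in> lists (S \<times> UNIV). length w = m \<and> word_value G w = g" by blast
  from LeastI_ex[OF this]
  show "word_length G S g \<le> n \<Longrightarrow>
    \<exists>w \<in> lists (S \<times> UNIV). length w \<le> n \<and> word_value G w = g"
    unfolding word_length_def by (smt (verit))
next
  assume "\<exists>w \<in> lists (S \<times> UNIV). length w \<le> n \<and> word_value G w = g"
  then obtain w where w: "w \<in> lists (S \<times> UNIV)" "length w \<le> n" "word_value G w = g" by blast
  then have "word_length G S g \<le> length w" unfolding word_length_def by (intro Least_le) blast
  then show "word_length G S g \<le> n" using w by simp
qed

lemma (in group) growth_ball_eq:
  assumes "finite_generating_set G S"
  shows "{g \<in> carrier G. word_length G S g \<le> n} =
    word_value G ` {w \<in> lists (S \<times> UNIV). length w \<le> n}"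
proof -
  have "word_value G w \<in> carrier G" if "w \<in> lists (S \<times> UNIV)" for w
    using word_value_closed[of S w] that assms unfolding finite_generating_set_def by blast
  then show ?thesis using word_length_le_iff[OF assms] by blast
qed

lemma (in group) finite_growth_ball:
  assumes "finite_generating_set G S"
  shows "finite {g \<in> carrier G. word_length G S g \<le> n}"
proof -
  have "finite (S \<times> (UNIV :: bool set))" using assms by (simp add: finite_generating_set_def)
  from finite_lists_length_le[OF this, of n]
  have "finite {w \<in> lists (S \<times> (UNIV :: bool set)). length w \<le> n}"
    by (simp add: lists_eq_set conj_commute)
  then show ?thesis unfolding growth_ball_eq[OF assms] by simp
qed

lemma (in group) growth_function_pos:
  assumes "finite_generating_set G S"
  shows "growth_function G S n > 0"
proof -
  have "word_value G [] \<in> {g \<in> carrier G. word_length G S g \<le> n}"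
    unfolding growth_ball_eq[OF assms] by (rule imageI) simp
  then show ?thesis
    using finite_growth_ball[OF assms] unfolding growth_function_def
    by (metis card_gt_0_iff empty_iff)
qed

lemma (in group) growth_function_submult:
  assumes "finite_generating_set G S"
  shows "growth_function G S (m + n) \<le> growth_function G S m * growth_function G S n"
proof -
  let ?B = "\<lambda>n. {g \<in> carrier G. word_length G S g \<le> n}"
  have S: "S \<subseteq> carrier G" using assms by (simp add: finite_generating_set_def)
  have "?B (m + n) \<subseteq> (\<lambda>(g, h). g \<otimes> h) ` (?B m \<times> ?B n)"
  proof
    fix g assume "g \<in> ?B (m + n)"
    then obtain w where w: "w \<in> lists (S \<times> UNIV)" "length w \<le> m + n" "g = word_value G w"
      unfolding growth_ball_eq[OF assms] by blast
    have tk: "take m w \<in> lists (S \<times> UNIV)" and dr: "drop m w \<in> lists (S \<times> UNIV)"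
      using w(1) by (auto simp: in_lists_conv_set dest: in_set_takeD in_set_dropD)
    have "word_value G (take m w) \<in> ?B m" "word_value G (drop m w) \<in> ?B n"
      unfolding growth_ball_eq[OF assms] using tk dr w(2) by (auto intro!: imageI)
    moreover have "g = word_value G (take m w) \<otimes> word_value G (drop m w)"
      using word_value_append[OF S tk dr] w(3) by simp
    ultimately show "g \<in> (\<lambda>(g, h). g \<otimes> h) ` (?B m \<times> ?B n)"
      by (intro image_eqI[of _ _ "(word_value G (take m w), word_value G (drop m w))"]) auto
  qed
  then have "card (?B (m + n)) \<le> card (?B m \<times> ?B n)"
    using finite_growth_ball[OF assms] by (intro surj_card_le) auto
  then show ?thesis by (simp add: growth_function_def card_cartesian_product)
qed

lemma subadditive_mult_le:
  fixes u :: "nat \<Rightarrow> real"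
  assumes "\<And>m n. u (m + n) \<le> u m + u n"
  shows "u (q * k + r) \<le> real q * u k + u r"
proof (induction q)
  case 0
  then show ?case by simp
next
  case (Suc q)
  have "u (Suc q * k + r) \<le> u k + u (q * k + r)" using assms[of k "q * k + r"] by (simp add: ac_simps)
  then show ?case using Suc by (simp add: algebra_simps)
qed

lemma fekete:
  fixes u :: "nat \<Rightarrow> real"
  assumes sub: "\<And>m n. u (m + n) \<le> u m + u n" and nonneg: "\<And>n. u n \<ge> 0"
  shows "convergent (\<lambda>n. u n / n)"
proof -
  define L where "L = (INF n \<in> {1..}. u n / n)"
  have bdd: "bdd_below ((\<lambda>n. u n / n) ` {1::nat..})"
    by (rule bdd_belowI[of _ 0]) (use nonneg in auto)
  have low: "L \<le> u n / n" if "n \<ge> 1" for n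
    unfolding L_def by (rule cINF_lower[OF bdd]) (use that in auto)
  have "(\<lambda>n. u n / n) \<longlonglongrightarrow> L"
  proof (rule LIMSEQ_I)
    fix e :: real assume e: "e > 0"
    have "\<exists>k \<in> {1::nat..}. u k / k < L + e / 2"
      unfolding L_def using e by (subst cINF_less_iff[symmetric, OF _ bdd]) auto
    then obtain k where k: "k \<ge> 1" "u k / k < L + e / 2" by auto
    define M where "M = (MAX r \<in> {..<k}. u r)"
    have M: "u r \<le> M" if "r < k" for r unfolding M_def by (rule Max_ge) (use that in auto)
    have M0: "M \<ge> 0" using M[of 0] nonneg[of 0] k by linarith
    obtain N where N: "real N > 2 * M / e" using reals_Archimedean2 by blast
    show "\<exists>no. \<forall>n \<ge> no. norm (u n / n - L) < e"
    proof (intro exI[of _ "Suc N"] allI impI)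
      fix n assume n: "n \<ge> Suc N"
      have n0: "real n > 0" using n by simp
      have "u n = u (n div k * k + n mod k)" by simp
      also have "\<dots> \<le> real (n div k) * u k + u (n mod k)" by (rule subadditive_mult_le[OF sub])
      also have "\<dots> \<le> (real n / real k) * u k + M"
      proof (rule add_mono)
        show "real (n div k) * u k \<le> (real n / real k) * u k"
          by (rule mult_right_mono[OF of_nat_div_le_of_nat nonneg])
        show "u (n mod k) \<le> M" using M k by simp
      qed
      finally have "u n / n \<le> ((real n / real k) * u k + M) / n" using n0 by (simp add: divide_right_mono)
      also have "\<dots> = u k / k + M / n" using n0 k by (simp add: field_simps)
      also have "M / n < e / 2"
      proof -
        have "2 * M / e < real n" using N n by linarith
        then have "2 * M < real n * e" using e by (simp add: pos_divide_less_eq)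
        then show ?thesis using n0 by (simp add: field_simps)
      qed
      finally have "u n / n < L + e" using k by linarith
      moreover have "L \<le> u n / n" using low n by simp
      ultimately show "norm (u n / n - L) < e" by simp
    qed
  qed
  then show ?thesis by (rule convergentI)
qed

text \<open>So the limit in \<open>growth_rate\<close> exists for every finite generating set.\<close>

lemma (in group) convergent_growth:
  assumes "finite_generating_set G S"
  shows "convergent (\<lambda>n. root n (real (growth_function G S n)))"
proof -
  define F where "F n = real (growth_function G S n)" for n
  have F1: "F n \<ge> 1" for n using growth_function_pos[OF assms, of n] by (simp add: F_def)
  have F0: "F n > 0" for n using F1[of n] by linarith
  have "convergent (\<lambda>n. ln (F n) / n)"
  proof (rule fekete)
    fix m n
    have "F (m + n) \<le> F m * F n"
      using growth_function_submult[OF assms, of m n] unfolding F_def of_nat_mult[symmetric] of_nat_le_iff .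
    then have "ln (F (m + n)) \<le> ln (F m * F n)" using F0 by (subst ln_le_cancel_iff) auto
    then show "ln (F (m + n)) \<le> ln (F m) + ln (F n)" using F0[of m] F0[of n] by (simp add: ln_mult)
  next
    show "ln (F n) \<ge> 0" for n using F1 by simp
  qed
  then obtain l where "(\<lambda>n. ln (F n) / n) \<longlonglongrightarrow> l" unfolding convergent_def by blast
  then have "(\<lambda>n. exp (ln (F n) / n)) \<longlonglongrightarrow> exp l" by (rule tendsto_exp)
  moreover have "eventually (\<lambda>n. exp (ln (F n) / n) = root n (F n)) sequentially"
    using eventually_gt_at_top[of 0]
  proof eventually_elim
    case (elim n)
    then show ?case using F0[of n] by (simp add: root_powr_inverse powr_def)
  qed
  ultimately have "(\<lambda>n. root n (F n)) \<longlonglongrightarrow> exp l" by (rule Lim_transform_eventually)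
  then show ?thesis unfolding F_def by (rule convergentI)
qed

section \<open>The presentation of the wreath product\<close>


lemma carrier_Z_wr_Z: "carrier Z_wr_Z = {f. finite {i. f i \<noteq> 0}} \<times> UNIV"
  by (auto simp: restricted_wreath_def carrier_sum_group)

lemma mult_Z_wr_Z:
  "(f, m) \<otimes>\<^bsub>Z_wr_Z\<^esub> (g, n) = ((\<lambda>i. f i + g (i - m)), m + n)"
  by (simp add: restricted_wreath_def restrict_def)

lemma one_Z_wr_Z: "\<one>\<^bsub>Z_wr_Z\<^esub> = ((\<lambda>i. 0), 0)"
  by (simp add: restricted_wreath_def restrict_def)

lemma finite_shift_support:
  fixes f :: "int \<Rightarrow> int"
  assumes "finite {i. f i \<noteq> 0}"
  shows "finite {i. f (i - m) \<noteq> 0}"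
proof -
  have "{i. f (i - m) \<noteq> 0} = (\<lambda>i. i + m) ` {i. f i \<noteq> 0}"
    by (auto intro!: image_eqI[of _ _ "_ - m"])
  then show ?thesis using assms by simp
qed

lemma group_Z_wr_Z: "group Z_wr_Z"
proof (rule groupI)
  fix x y assume xy: "x \<in> carrier Z_wr_Z" "y \<in> carrier Z_wr_Z"
  obtain f m g n where [simp]: "x = (f, m)" "y = (g, n)" by (metis surj_pair)
  have "finite ({i. f i \<noteq> 0} \<union> {i. g (i - m) \<noteq> 0})"
    using xy finite_shift_support by (auto simp: carrier_Z_wr_Z)
  then have "finite {i. f i + g (i - m) \<noteq> 0}" by (rule rev_finite_subset) auto
  then show "x \<otimes>\<^bsub>Z_wr_Z\<^esub> y \<in> carrier Z_wr_Z" by (simp add: carrier_Z_wr_Z mult_Z_wr_Z)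
next
  show "\<one>\<^bsub>Z_wr_Z\<^esub> \<in> carrier Z_wr_Z" by (simp add: one_Z_wr_Z carrier_Z_wr_Z)
next
  fix x y z :: "(int \<Rightarrow> int) \<times> int"
  obtain f m g n h k where "x = (f, m)" "y = (g, n)" "z = (h, k)" by (metis surj_pair)
  then show "x \<otimes>\<^bsub>Z_wr_Z\<^esub> y \<otimes>\<^bsub>Z_wr_Z\<^esub> z = x \<otimes>\<^bsub>Z_wr_Z\<^esub> (y \<otimes>\<^bsub>Z_wr_Z\<^esub> z)"
    by (simp add: mult_Z_wr_Z algebra_simps)
next
  fix x :: "(int \<Rightarrow> int) \<times> int"
  show "\<one>\<^bsub>Z_wr_Z\<^esub> \<otimes>\<^bsub>Z_wr_Z\<^esub> x = x" by (cases x) (simp add: mult_Z_wr_Z one_Z_wr_Z)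
next
  fix x assume x: "x \<in> carrier Z_wr_Z"
  obtain f m where [simp]: "x = (f, m)" by force
  have "finite {i. f (i - (- m)) \<noteq> 0}"
    using x by (intro finite_shift_support) (simp add: carrier_Z_wr_Z)
  then have "((\<lambda>i. - f (i + m)), - m) \<in> carrier Z_wr_Z" by (simp add: carrier_Z_wr_Z)
  moreover have "((\<lambda>i. - f (i + m)), - m) \<otimes>\<^bsub>Z_wr_Z\<^esub> x = \<one>\<^bsub>Z_wr_Z\<^esub>"
    by (simp add: mult_Z_wr_Z one_Z_wr_Z)
  ultimately show "\<exists>y \<in> carrier Z_wr_Z. y \<otimes>\<^bsub>Z_wr_Z\<^esub> x = \<one>\<^bsub>Z_wr_Z\<^esub>" by blast
qed

interpretation Z_wr_Z: group Z_wr_Z by (rule group_Z_wr_Z)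

lemma gens_in_carrier: "{gen_a, gen_t} \<subseteq> carrier Z_wr_Z"
  by (auto simp: gen_a_def gen_t_def carrier_Z_wr_Z)

lemma inv_gen_a: "inv\<^bsub>Z_wr_Z\<^esub> gen_a = ((\<lambda>i. if i = 0 then - 1 else 0), 0)"
  using gens_in_carrier by (intro Z_wr_Z.inv_equality)
    (auto simp: gen_a_def carrier_Z_wr_Z mult_Z_wr_Z one_Z_wr_Z)

lemma inv_gen_t: "inv\<^bsub>Z_wr_Z\<^esub> gen_t = ((\<lambda>i. 0), - 1)"
  using gens_in_carrier by (intro Z_wr_Z.inv_equality)
    (auto simp: gen_t_def carrier_Z_wr_Z mult_Z_wr_Z one_Z_wr_Z)

lemma gen_a_neq_gen_t: "gen_a \<noteq> gen_t"
  by (simp add: gen_a_def gen_t_def)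

abbreviation (input) at_words :: "((int \<Rightarrow> int) \<times> int) gword set" where
  "at_words \<equiv> lists ({gen_a, gen_t} \<times> UNIV)"

abbreviation (input) relators :: "((int \<Rightarrow> int) \<times> int) gword set" where
  "relators \<equiv> {Z_wr_Z_relator k | k. k \<ge> 1}"

abbreviation weq :: "((int \<Rightarrow> int) \<times> int) gword \<Rightarrow> ((int \<Rightarrow> int) \<times> int) gword \<Rightarrow> bool" (infix "\<doteq>" 50) where
  "u \<doteq> v \<equiv> word_equiv {gen_a, gen_t} {Z_wr_Z_relator k | k. k \<ge> 1} u v"

abbreviation "wv \<equiv> word_value Z_wr_Z"

lemma weq_app:
  assumes "word_equiv X R u v"
  shows "word_equiv X R (p @ u @ q) (p @ v @ q)"
  using assms
proof induction
  case (word_equiv_cancel x u b v)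
  then show ?case using word_equiv.word_equiv_cancel[of x X R "p @ u" b "v @ q"] by simp
next
  case (word_equiv_relator r u v)
  then show ?case using word_equiv.word_equiv_relator[of r R X "p @ u" "v @ q"] by simp
qed (blast intro: word_equiv.intros)+

lemma weq_cong:
  assumes "word_equiv X R u u'" "word_equiv X R v v'"
  shows "word_equiv X R (u @ v) (u' @ v')"
  using weq_app[OF assms(1), of "[]" v] weq_app[OF assms(2), of u' "[]"]
  by (auto intro: word_equiv_trans)

lemma word_inv_word_inv [simp]: "word_inv (word_inv w) = w"
  by (induction w) (auto simp: word_inv_def rev_map)

lemma word_inv_append [simp]: "word_inv (u @ v) = word_inv v @ word_inv u"
  by (simp add: word_inv_def)

lemma word_inv_Nil [simp]: "word_inv [] = []"
  by (simp add: word_inv_def)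

lemma word_inv_Cons [simp]: "word_inv ((x, b) # w) = word_inv w @ [(x, \<not> b)]"
  by (simp add: word_inv_def)

lemma word_inv_in_lists: "w \<in> lists (X \<times> UNIV) \<Longrightarrow> word_inv w \<in> lists (X \<times> UNIV)"
  by (auto simp: word_inv_def in_lists_conv_set)

lemma weq_right_inv:
  assumes "w \<in> lists (X \<times> UNIV)"
  shows "word_equiv X R (w @ word_inv w) []"
  using assms
proof (induction w)
  case Nil
  then show ?case by (simp add: word_inv_def word_equiv_refl)
next
  case (Cons p w)
  obtain x b where p: "p = (x, b)" by force
  have x: "x \<in> X" using Cons p by auto
  have e: "(p # w) @ word_inv (p # w) = [p] @ (w @ word_inv w) @ [(x, \<not> b)]"
    by (simp add: word_inv_def p)
  have "word_equiv X R ([p] @ (w @ word_inv w) @ [(x, \<not> b)]) ([p] @ [] @ [(x, \<not> b)])"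
    using Cons by (intro weq_app) auto
  moreover have "word_equiv X R ([p] @ [] @ [(x, \<not> b)]) []"
    using word_equiv_cancel[OF x, of R "[]" b "[]"] p by simp
  ultimately show ?case unfolding e by (rule word_equiv_trans)
qed

lemma weq_left_inv:
  assumes "w \<in> lists (X \<times> UNIV)"
  shows "word_equiv X R (word_inv w @ w) []"
  using weq_right_inv[OF word_inv_in_lists[OF assms], of R] by simp

lemma weq_left_cancel:
  assumes "w \<in> lists (X \<times> UNIV)" "word_equiv X R (w @ u) (w @ v)"
  shows "word_equiv X R u v"
proof -
  have *: "word_equiv X R ((word_inv w @ w) @ z) z" for z
    using weq_app[OF weq_left_inv[OF assms(1)], of R "[]" z] by simp
  have "word_equiv X R (word_inv w @ w @ u) (word_inv w @ w @ v)"
    using weq_app[OF assms(2), of "word_inv w" "[]"] by simp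
  with *[of u] *[of v] show ?thesis
    by (metis append.assoc word_equiv_sym word_equiv_trans)
qed

lemma weq_commute_inv:
  assumes "u \<in> lists (X \<times> UNIV)" "word_equiv X R (u @ v) (v @ u)"
  shows "word_equiv X R (word_inv u @ v) (v @ word_inv u)"
proof (rule weq_left_cancel[OF assms(1)])
  have 1: "word_equiv X R (u @ word_inv u @ v) v"
    using weq_app[OF weq_right_inv[OF assms(1)], of R "[]" v] by simp
  have 2: "word_equiv X R (u @ v @ word_inv u) (v @ u @ word_inv u)"
    using weq_app[OF assms(2), of "[]" "word_inv u"] by simp
  have 3: "word_equiv X R (v @ u @ word_inv u) v"
    using weq_app[OF weq_right_inv[OF assms(1)], of R v "[]"] by simp
  show "word_equiv X R (u @ word_inv u @ v) (u @ v @ word_inv u)"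
    using 1 2 3 by (meson word_equiv_sym word_equiv_trans)
qed

lemma weq_commutator:
  assumes uv: "u \<in> lists (X \<times> UNIV)" "v \<in> lists (X \<times> UNIV)"
    and "word_commutator u v \<in> R"
  shows "word_equiv X R (u @ v) (v @ u)"
proof -
  have 1: "word_equiv X R (word_commutator u v @ v @ u) (v @ u)"
    using word_equiv_relator[OF assms(3), of X "[]" "v @ u"] by simp
  have "word_equiv X R ((u @ v @ word_inv u) @ (word_inv v @ v) @ u) ((u @ v @ word_inv u) @ [] @ u)"
    by (intro weq_app weq_left_inv uv)
  moreover have "word_equiv X R ((u @ v) @ (word_inv u @ u) @ []) ((u @ v) @ [] @ [])"
    by (intro weq_app weq_left_inv uv)
  ultimately show ?thesis using 1 unfolding word_commutator_def
    by (simp, meson word_equiv_sym word_equiv_trans)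
qed

definition tpow :: "int \<Rightarrow> ((int \<Rightarrow> int) \<times> int) gword" where
  "tpow n = (if n \<ge> 0 then replicate (nat n) (gen_t, True) else replicate (nat (- n)) (gen_t, False))"

definition lamp :: "int \<times> bool \<Rightarrow> ((int \<Rightarrow> int) \<times> int) gword" where
  "lamp p = tpow (fst p) @ [(gen_a, snd p)] @ tpow (- fst p)"

definition lamps :: "(int \<times> bool) list \<Rightarrow> ((int \<Rightarrow> int) \<times> int) gword" where
  "lamps L = concat (map lamp L)"

lemma tpow_in [simp]: "tpow n \<in> at_words"
  by (auto simp: tpow_def in_lists_conv_set)

lemma lamp_in [simp]: "lamp p \<in> at_words"
  using tpow_in by (auto simp: lamp_def in_lists_conv_set)

lemma lamps_in [simp]: "lamps L \<in> at_words"
  using lamp_in by (induction L) (auto simp: lamps_def in_lists_conv_set)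

lemma tpow_0 [simp]: "tpow 0 = []" by (simp add: tpow_def)

lemma word_inv_tpow [simp]: "word_inv (tpow n) = tpow (- n)"
  by (auto simp: word_inv_def tpow_def)

lemma word_inv_lamp: "word_inv (lamp (k, b)) = lamp (k, \<not> b)"
  by (simp add: lamp_def)

lemma tpow_True: "(gen_t, True) # tpow n \<doteq> tpow (1 + n)"
proof (cases "n \<ge> 0")
  case True
  then have "tpow (1 + n) = (gen_t, True) # tpow n"
    by (simp add: tpow_def nat_add_distrib)
  then show ?thesis by (simp add: word_equiv_refl)
next
  case False
  then have "nat (- n) = Suc (nat (- (1 + n)))" by simp
  then have "tpow n = (gen_t, False) # tpow (1 + n)"
    using False by (auto simp: tpow_def)
  then show ?thesis
    using word_equiv_cancel[of gen_t "{gen_a, gen_t}" relators "[]" True "tpow (1 + n)"] by simp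
qed

lemma tpow_False: "(gen_t, False) # tpow n \<doteq> tpow (n - 1)"
proof -
  have "[(gen_t, False)] @ ((gen_t, True) # tpow (n - 1)) \<doteq> [(gen_t, False)] @ tpow n"
    using tpow_True[of "n - 1"] by (intro weq_cong word_equiv_refl) simp
  moreover have "[(gen_t, False)] @ ((gen_t, True) # tpow (n - 1)) \<doteq> tpow (n - 1)"
    using word_equiv_cancel[of gen_t "{gen_a, gen_t}" relators "[]" False "tpow (n - 1)"] by simp
  ultimately show ?thesis by (simp, meson word_equiv_sym word_equiv_trans)
qed

lemma tpow_add: "tpow m @ tpow n \<doteq> tpow (m + n)"
proof -
  have pos: "replicate j (gen_t, True) @ tpow n \<doteq> tpow (int j + n)" for j
  proof (induction j)
    case 0
    then show ?case by (simp add: word_equiv_refl)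
  next
    case (Suc j)
    have "[(gen_t, True)] @ replicate j (gen_t, True) @ tpow n \<doteq> [(gen_t, True)] @ tpow (int j + n)"
      by (intro weq_cong word_equiv_refl Suc)
    then show ?case using tpow_True[of "int j + n"] by (simp add: ac_simps) (meson word_equiv_trans)
  qed
  have neg: "replicate j (gen_t, False) @ tpow n \<doteq> tpow (n - int j)" for j
  proof (induction j)
    case 0
    then show ?case by (simp add: word_equiv_refl)
  next
    case (Suc j)
    have "[(gen_t, False)] @ replicate j (gen_t, False) @ tpow n \<doteq> [(gen_t, False)] @ tpow (n - int j)"
      by (intro weq_cong word_equiv_refl Suc)
    then show ?case using tpow_False[of "n - int j"]
      by (simp add: algebra_simps) (meson word_equiv_trans)
  qed
  show ?thesis using pos[of "nat m"] neg[of "nat (- m)"]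
    by (cases "m \<ge> 0") (auto simp: tpow_def[of m] add.commute)
qed

lemma tpow_lamp: "tpow m @ lamp (k, b) \<doteq> lamp (m + k, b) @ tpow m"
proof -
  have "(tpow m @ tpow k) @ ([(gen_a, b)] @ tpow (- k)) \<doteq>
      tpow (m + k) @ ([(gen_a, b)] @ (tpow (- (m + k)) @ tpow m))"
    using tpow_add[of "- (m + k)" m]
    by (intro weq_cong tpow_add word_equiv_refl) (simp add: word_equiv_sym)
  then show ?thesis by (simp add: lamp_def)
qed

lemma tpow_lamps: "tpow m @ lamps L \<doteq> lamps (map (\<lambda>(k, b). (m + k, b)) L) @ tpow m"
proof (induction L)
  case Nil
  then show ?case by (simp add: lamps_def word_equiv_refl)
next
  case (Cons p L)
  obtain k b where p: "p = (k, b)" by force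
  let ?s = "map (\<lambda>(k, b). (m + k, b)) L"
  have "(tpow m @ lamp (k, b)) @ lamps L \<doteq> (lamp (m + k, b) @ tpow m) @ lamps L"
    by (intro weq_cong tpow_lamp word_equiv_refl)
  moreover have "lamp (m + k, b) @ (tpow m @ lamps L) \<doteq> lamp (m + k, b) @ (lamps ?s @ tpow m)"
    by (intro weq_cong Cons word_equiv_refl)
  ultimately show ?case by (simp add: p lamps_def) (meson word_equiv_trans)
qed

text \<open>Every word is a product of conjugates \<open>t\<^sup>k a\<^sup>\<plusminus>\<^sup>1 t\<^sup>-\<^sup>k\<close> followed by a power of \<open>t\<close>.\<close>

lemma word_normal_form:
  assumes "w \<in> at_words"
  shows "\<exists>L n. w \<doteq> lamps L @ tpow n"
  using assms
proof (induction w)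
  case Nil
  show ?case by (intro exI[of _ "[]"] exI[of _ 0]) (simp add: lamps_def word_equiv_refl)
next
  case (Cons p w)
  obtain x b where p: "p = (x, b)" by (cases p)
  obtain L n where IH: "w \<doteq> lamps L @ tpow n" using Cons.IH by blast
  have "[p] @ w \<doteq> [p] @ (lamps L @ tpow n)" by (intro weq_cong word_equiv_refl IH)
  then have 1: "p # w \<doteq> p # (lamps L @ tpow n)" by simp
  show ?case
  proof (cases "x = gen_a")
    case True
    then have "p # (lamps L @ tpow n) = lamps ((0, b) # L) @ tpow n"
      by (simp add: lamps_def lamp_def p)
    with 1 have "p # w \<doteq> lamps ((0, b) # L) @ tpow n" by (simp only:)
    then show ?thesis by blast
  next
    case False
    then have x: "x = gen_t" using Cons.hyps(1) p by auto
    define m :: int where "m = (if b then 1 else - 1)"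
    have pm: "[p] = tpow m" by (simp add: m_def tpow_def p x)
    let ?s = "map (\<lambda>(k, b). (m + k, b)) L"
    have "(tpow m @ lamps L) @ tpow n \<doteq> (lamps ?s @ tpow m) @ tpow n"
      by (intro weq_cong tpow_lamps word_equiv_refl)
    moreover have "lamps ?s @ (tpow m @ tpow n) \<doteq> lamps ?s @ tpow (m + n)"
      by (intro weq_cong tpow_add word_equiv_refl)
    ultimately have "(tpow m @ lamps L) @ tpow n \<doteq> lamps ?s @ tpow (m + n)"
      by (simp, meson word_equiv_trans)
    moreover have "p # (lamps L @ tpow n) = (tpow m @ lamps L) @ tpow n" 
      unfolding pm[symmetric] by simp
    ultimately have "p # w \<doteq> lamps ?s @ tpow (m + n)" using 1 by (simp only:) (rule word_equiv_trans)
    then show ?thesis by blast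
  qed
qed

lemma lamp_commute_gen_a:
  assumes "k \<ge> 1"
  shows "lamp (k, True) @ lamp (0, True) \<doteq> lamp (0, True) @ lamp (k, True)"
proof (rule weq_commutator)
  have "Z_wr_Z_relator (nat k) \<in> relators" using assms by auto
  moreover have "word_commutator (lamp (k, True)) (lamp (0, True)) = Z_wr_Z_relator (nat k)"
    using assms by (simp add: Z_wr_Z_relator_def lamp_def tpow_def)
  ultimately show "word_commutator (lamp (k, True)) (lamp (0, True)) \<in> relators" by simp
qed (rule lamp_in)+

lemma lamp_commute_less:
  assumes "k < l"
  shows "lamp (l, True) @ lamp (k, True) \<doteq> lamp (k, True) @ lamp (l, True)"
proof -
  let ?L = "[(l - k, True), (0, True)]" and ?L' = "[(0, True), (l - k, True)]"
  have "lamps ?L \<doteq> lamps ?L'"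
    using lamp_commute_gen_a[of "l - k"] assms by (simp add: lamps_def)
  then have "tpow k @ lamps ?L \<doteq> tpow k @ lamps ?L'"
    by (intro weq_cong word_equiv_refl)
  then have "lamps [(l, True), (k, True)] @ tpow k \<doteq> lamps [(k, True), (l, True)] @ tpow k"
    using tpow_lamps[of k ?L] tpow_lamps[of k ?L']
    by (simp, meson word_equiv_sym word_equiv_trans)
  then have 1: "(lamps [(l, True), (k, True)] @ tpow k) @ tpow (- k) \<doteq>
      (lamps [(k, True), (l, True)] @ tpow k) @ tpow (- k)"
    by (rule weq_cong[OF _ word_equiv_refl])
  have 2: "(u @ tpow k) @ tpow (- k) \<doteq> u" for u
    using weq_cong[OF word_equiv_refl tpow_add[of k "- k"], of u] by simp
  have "lamps [(l, True), (k, True)] \<doteq> lamps [(k, True), (l, True)]"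
    using 1 2[of "lamps [(l, True), (k, True)]"] 2[of "lamps [(k, True), (l, True)]"]
    by (meson word_equiv_sym word_equiv_trans)
  then show ?thesis by (simp add: lamps_def)
qed

lemma lamp_commute: "lamp p @ lamp q \<doteq> lamp q @ lamp p"
proof -
  have TT: "lamp (k, True) @ lamp (l, True) \<doteq> lamp (l, True) @ lamp (k, True)" for k l
    using lamp_commute_less[of k l] lamp_commute_less[of l k]
    by (cases k l rule: linorder_cases) (auto intro: word_equiv_sym word_equiv_refl)
  have T: "lamp (k, b) @ lamp (l, True) \<doteq> lamp (l, True) @ lamp (k, b)" for k b l
    using TT[of k l] weq_commute_inv[OF lamp_in TT[of k l]] unfolding word_inv_lamp
    by (cases b) (simp_all only: not_True_eq_False)
  have "lamp (k, b) @ lamp (l, c) \<doteq> lamp (l, c) @ lamp (k, b)" for k b l c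
  proof (cases c)
    case True
    then show ?thesis using T[of k b l] by (simp only:)
  next
    case False
    have "lamp (l, False) @ lamp (k, b) \<doteq> lamp (k, b) @ lamp (l, False)"
      using weq_commute_inv[OF lamp_in T[of k b l, THEN word_equiv_sym]]
      unfolding word_inv_lamp by (simp only: not_True_eq_False)
    then have "lamp (k, b) @ lamp (l, False) \<doteq> lamp (l, False) @ lamp (k, b)"
      by (rule word_equiv_sym)
    then show ?thesis using False by simp
  qed
  from this[of "fst p" "snd p" "fst q" "snd q"] show ?thesis by simp
qed

lemma lamp_lamps_commute: "lamps L @ lamp q \<doteq> lamp q @ lamps L"
proof (induction L)
  case Nil
  then show ?case by (simp add: lamps_def word_equiv_refl)
next
  case (Cons p L)
  have "lamp p @ (lamps L @ lamp q) \<doteq> lamp p @ (lamp q @ lamps L)"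
    by (intro weq_cong word_equiv_refl Cons)
  moreover have "(lamp p @ lamp q) @ lamps L \<doteq> (lamp q @ lamp p) @ lamps L"
    by (intro weq_cong word_equiv_refl lamp_commute)
  ultimately show ?case by (simp add: lamps_def) (meson word_equiv_trans)
qed

definition lamp_count :: "(int \<times> bool) list \<Rightarrow> int \<Rightarrow> int" where
  "lamp_count L i = (\<Sum>p \<leftarrow> L. if fst p = i then (if snd p then 1 else - 1) else 0)"

lemma lamps_trivial:
  assumes "\<And>i. lamp_count L i = 0"
  shows "lamps L \<doteq> []"
  using assms
proof (induction L rule: length_induct)
  case (1 L)
  show ?case
  proof (cases L)
    case Nil
    then show ?thesis by (simp add: lamps_def word_equiv_refl)
  next
    case (Cons p L')
    obtain k b where p: "p = (k, b)" by force
    have cnt: "lamp_count L' k = (if b then - 1 else 1)"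
      using 1(2)[rule_format, of k] by (auto simp: Cons p lamp_count_def split: if_splits)
    have "(k, \<not> b) \<in> set L'"
    proof (rule ccontr)
      assume "(k, \<not> b) \<notin> set L'"
      then have "(if b then lamp_count L' k \<ge> 0 else lamp_count L' k \<le> 0)"
        by (induction L') (auto simp: lamp_count_def split: if_splits)
      with cnt show False by (auto split: if_splits)
    qed
    then obtain L1 L2 where L': "L' = L1 @ (k, \<not> b) # L2" by (meson split_list)
    have 0: "lamp_count (L1 @ L2) i = 0" for i
      using 1(2)[rule_format, of i] by (auto simp: Cons p L' lamp_count_def split: if_splits)
    have IH: "lamps (L1 @ L2) \<doteq> []"
      using 1(1) 0 by (auto simp: Cons L')
    have "lamp (k, b) @ ((lamps L1 @ lamp (k, \<not> b)) @ lamps L2) \<doteq>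
        lamp (k, b) @ ((lamp (k, \<not> b) @ lamps L1) @ lamps L2)"
      by (intro weq_cong word_equiv_refl lamp_lamps_commute)
    moreover have "(lamp (k, b) @ lamp (k, \<not> b)) @ lamps (L1 @ L2) \<doteq> [] @ []"
      using weq_right_inv[OF lamp_in, of _ "(k, b)"] unfolding word_inv_lamp
      by (intro weq_cong IH)
    ultimately show ?thesis by (simp add: Cons p L' lamps_def) (meson word_equiv_trans)
  qed
qed

lemmas wv_append = Z_wr_Z.word_value_append[OF gens_in_carrier]

lemma wv_Cons:
  "wv ((x, b) # w) = (if b then x else inv\<^bsub>Z_wr_Z\<^esub> x) \<otimes>\<^bsub>Z_wr_Z\<^esub> wv w"
  by (simp add: word_value_def)

lemma wv_Nil: "wv [] = ((\<lambda>i. 0), 0)"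
  by (simp add: word_value_def one_Z_wr_Z)

lemma wv_tpow: "wv (tpow n) = ((\<lambda>i. 0), n)"
proof -
  have "wv (replicate j (gen_t, True)) = ((\<lambda>i. 0), int j)" for j
    by (induction j) (auto simp: wv_Nil wv_Cons gen_t_def mult_Z_wr_Z)
  moreover have "wv (replicate j (gen_t, False)) = ((\<lambda>i. 0), - int j)" for j
    by (induction j) (auto simp: wv_Nil wv_Cons inv_gen_t mult_Z_wr_Z)
  ultimately show ?thesis by (simp add: tpow_def)
qed

lemma wv_lamp:
  "wv (lamp (k, b)) = ((\<lambda>i. if k = i then (if b then 1 else - 1) else 0), 0)"
proof -
  have "wv (lamp (k, b)) = wv (tpow k) \<otimes>\<^bsub>Z_wr_Z\<^esub> (wv [(gen_a, b)] \<otimes>\<^bsub>Z_wr_Z\<^esub> wv (tpow (- k)))"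
    using wv_append[OF tpow_in, of "[(gen_a, b)] @ tpow (- k)" k]
      wv_append[OF _ tpow_in, of "[(gen_a, b)]" "- k"]
    by (simp add: lamp_def)
  also have "wv [(gen_a, b)] = ((\<lambda>i. if i = 0 then (if b then 1 else - 1) else 0), 0)"
    by (cases b) (simp_all add: wv_Cons wv_Nil inv_gen_a mult_Z_wr_Z, simp add: gen_a_def mult_Z_wr_Z)
  finally show ?thesis by (auto simp: wv_tpow mult_Z_wr_Z fun_eq_iff)
qed

lemma wv_lamps: "wv (lamps L) = (lamp_count L, 0)"
proof (induction L)
  case Nil
  then show ?case by (simp add: lamps_def wv_Nil lamp_count_def fun_eq_iff)
next
  case (Cons p L)
  have "wv (lamps (p # L)) = wv (lamp p) \<otimes>\<^bsub>Z_wr_Z\<^esub> wv (lamps L)"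
    using wv_append[OF lamp_in lamps_in] by (simp add: lamps_def)
  then show ?case using Cons
    by (cases p) (auto simp: wv_lamp mult_Z_wr_Z lamp_count_def fun_eq_iff)
qed

lemma wv_normal_form: "wv (lamps L @ tpow n) = (lamp_count L, n)"
  by (subst wv_append) (auto simp: wv_lamps wv_tpow mult_Z_wr_Z)

lemma relator_in: "Z_wr_Z_relator k \<in> at_words"
  by (auto simp: Z_wr_Z_relator_def word_commutator_def word_inv_def in_lists_conv_set)

lemma wv_relator: "wv (Z_wr_Z_relator k) = wv []"
proof -
  have "Z_wr_Z_relator k =
      lamps [(int k, True), (0, True), (int k, False), (0, False)] @ tpow 0"
    by (simp add: Z_wr_Z_relator_def word_commutator_def word_inv_def lamps_def lamp_def tpow_def)
  then show ?thesis unfolding wv_normal_form wv_Nil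
    by (simp only: wv_normal_form) (auto simp: lamp_count_def fun_eq_iff)
qed

lemma weq_wv: 
  assumes "u \<doteq> v"
  shows "(u \<in> at_words \<longleftrightarrow> v \<in> at_words) \<and> (u \<in> at_words \<longrightarrow> wv u = wv v)"
  using assms
proof induction
  case (word_equiv_cancel x u b v)
  have x: "x \<in> carrier Z_wr_Z" using word_equiv_cancel gens_in_carrier by auto
  have c: "[(x, b), (x, \<not> b)] \<in> at_words" using word_equiv_cancel by auto
  have "wv [(x, b), (x, \<not> b)] = wv []"
    using x by (simp add: word_value_def)
  then have "wv (u @ [(x, b), (x, \<not> b)] @ v) = wv (u @ [] @ v)" if "u \<in> at_words" "v \<in> at_words"
    using that c by (simp only: wv_append append_in_lists_conv lists.Nil)
  then show ?case using c by auto
next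
  case (word_equiv_relator r u v)
  then obtain k where r: "r = Z_wr_Z_relator k" by blast
  have "wv (u @ r @ v) = wv (u @ [] @ v)" if "u \<in> at_words" "v \<in> at_words"
    using that relator_in[of k] wv_relator[of k] r by (simp only: wv_append append_in_lists_conv lists.Nil)
  then show ?case using relator_in[of k] r by auto
qed auto

lemma generate_Z_wr_Z: "generate Z_wr_Z {gen_a, gen_t} = carrier Z_wr_Z"
proof
  show "generate Z_wr_Z {gen_a, gen_t} \<subseteq> carrier Z_wr_Z"
    by (rule Z_wr_Z.generate_incl[OF gens_in_carrier])
  have pw: "\<exists>L. lamp_count L = (\<lambda>i. if i = k then c else 0)" for k c
  proof (intro exI ext)
    fix i
    show "lamp_count (replicate (nat \<bar>c\<bar>) (k, c \<ge> 0)) i = (if i = k then c else 0)"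
      by (auto simp: lamp_count_def sum_list_replicate)
  qed
  have "\<exists>L. lamp_count L = f" if "finite I" "{i. f i \<noteq> 0} \<subseteq> I" for I f
    using that
  proof (induction I arbitrary: f)
    case empty
    then show ?case by (intro exI[of _ "[]"]) (auto simp: lamp_count_def)
  next
    case (insert k I)
    have "{i. (f(k := 0)) i \<noteq> 0} \<subseteq> I" using insert.prems by auto
    from insert.IH[OF this] obtain L where L: "lamp_count L = f(k := 0)" by blast
    obtain L' where L': "lamp_count L' = (\<lambda>i. if i = k then f k else 0)" using pw by blast
    have "lamp_count (L @ L') i = lamp_count L i + lamp_count L' i" for i
      by (simp add: lamp_count_def)
    then have "lamp_count (L @ L') = f" using L L' by (auto simp: fun_eq_iff)
    then show ?case by blast
  qed
  then have ex: "\<exists>L. lamp_count L = f" if "finite {i. f i \<noteq> 0}" for f using that by blast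
  show "carrier Z_wr_Z \<subseteq> generate Z_wr_Z {gen_a, gen_t}"
  proof
    fix x assume "x \<in> carrier Z_wr_Z"
    then have "finite {i. fst x i \<noteq> 0}" by (auto simp: carrier_Z_wr_Z)
    then obtain L where "lamp_count L = fst x" using ex by blast
    then have "x = wv (lamps L @ tpow (snd x))" by (simp add: wv_normal_form)
    moreover have "lamps L @ tpow (snd x) \<in> at_words" by simp
    ultimately show "x \<in> generate Z_wr_Z {gen_a, gen_t}"
      using Z_wr_Z.word_value_in_generate by metis
  qed
qed

lemma presentation_Z_wr_Z:
  "has_presentation Z_wr_Z {gen_a, gen_t} {Z_wr_Z_relator k | k. k \<ge> 1}"
  unfolding has_presentation_def
proof (intro conjI ballI iffI)
  fix w assume w: "w \<in> at_words"
  obtain L n where nf: "w \<doteq> lamps L @ tpow n" using word_normal_form[OF w] by blast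
  have v: "wv w = (lamp_count L, n)" using weq_wv[OF nf] w wv_normal_form by auto
  assume "wv w = \<one>\<^bsub>Z_wr_Z\<^esub>"
  then have "n = 0" "lamp_count L i = 0" for i using v by (auto simp: one_Z_wr_Z fun_eq_iff)
  then have "lamps L @ tpow n \<doteq> []" using lamps_trivial by simp
  with nf show "w \<doteq> []" by (rule word_equiv_trans)
next
  fix w assume w: "w \<in> at_words" "w \<doteq> []"
  then show "wv w = \<one>\<^bsub>Z_wr_Z\<^esub>" using weq_wv[OF w(2)] by (simp add: wv_Nil one_Z_wr_Z)
qed (use gens_in_carrier generate_Z_wr_Z relator_in in auto)

lemma finite_generating_set_gens: "finite_generating_set Z_wr_Z {gen_a, gen_t}"
  using gens_in_carrier generate_Z_wr_Z by (simp add: finite_generating_set_def)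

no_notation weq (infix "\<doteq>" 50)

end

theory Submission
  imports Defs
begin

text \<open>
  The presentation and the fact that \<open>a\<close> and \<open>t\<close> generate are \<open>presentation_Z_wr_Z\<close> and
  \<open>finite_generating_set_gens\<close>. What remains is an upper bound \<open>1 + \<surd>2\<close> for the growth
  rate of \<open>{a, t}\<close>, and the same number as a lower bound for every finite generating set \<open>S\<close>.
  Throughout, an element is a pair of a finitely supported lamp configuration and a position in
  \<open>\<int>\<close>; \<open>snd\<close> is the homomorphism onto \<open>\<int>\<close>. The number \<open>z = \<surd>2 - 1\<close> is the positive root of
  \<open>z\<^sup>2 + 2 z = 1\<close>, equivalently of \<open>\<Sum>\<^sub>e z\<^bsup>|e| + 1\<^esup> = 1\<close> and of \<open>\<Sum>\<^sub>e z\<^bsup>|2 e - 1|\<^esup> = 1\<close>, both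
  sums over \<open>e \<in> \<int>\<close>.

  Upper bound. A word of length \<open>n\<close> in \<open>a, t\<close> describes a walk on \<open>\<int>\<close> that visits an interval
  \<open>[l, r]\<close> containing the support, so it reaches \<open>(f, m)\<close> only if
  \<open>\<Sum>|f i| + 2 (r - l) - |m| \<le> n\<close> (\<open>at_word_tour\<close>). Weighting each configuration on the interval by
  \<open>z\<close> to the power \<open>\<Sum>|f i|\<close> makes every site contribute at most \<open>(1 + z) / (1 - z) = 1 + \<surd>2\<close>, and
  the ball of radius \<open>n\<close> has at most a polynomial in \<open>n\<close> times \<open>(1 + \<surd>2)\<^sup>n\<close> elements.

  Lower bound. If blocks \<open>b\<^sub>e\<close>, indexed by the integers, have length at most \<open>|e| + 1\<close>, or at most
  \<open>|2 e - 1|\<close>, and the product of a list of \<open>k\<close> blocks determines the list, then counting these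
  products gives growth rate at least \<open>1 + \<surd>2\<close> (\<open>growth_rate_ge_silver\<close>). Such blocks exist for
  every \<open>S\<close>:

  \<^item> If \<open>S\<close> contains \<open>s \<noteq> 1\<close> with \<open>snd s = 0\<close>, pick \<open>x\<close> in \<open>S\<close> or its inverse with
    \<open>snd x > 0\<close> and take the blocks \<open>s\<^sup>e x\<close>.
  \<^item> Otherwise there are non-commuting \<open>x, y\<close> in \<open>S\<close> or its inverses with
    \<open>0 < snd x \<le> snd y\<close>. If \<open>snd x = snd y\<close>, take \<open>u\<^sup>e x\<close> with \<open>u = y x\<^sup>-\<^sup>1\<close>, of length at
    most \<open>|2 e - 1|\<close> because \<open>u x = y\<close>.
  \<^item> In the remaining cases powers of a position-raising \<open>u\<close> alternate with \<open>v\<close>. The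
    products \<open>u\<^sup>e v\<close> are no longer distinct for all \<open>e\<close>, but they are for \<open>e \<ge> -K\<close> when
    \<open>K \<cdot> snd u \<le> snd v\<close>, and the missing indices can be given to the blocks
    \<open>u v\<^sup>-\<^sup>1 u\<^sup>d v\<close> with \<open>d \<ge> 1\<close> without exceeding the permitted lengths. One uses \<open>u = x\<close>,
    \<open>v = y\<close>, \<open>K = 2\<close> when \<open>snd y \<ge> 2 \<cdot> snd x\<close>, and \<open>u = y x\<^sup>-\<^sup>1\<close>, \<open>v = x\<close>, \<open>K = 1\<close> when
    \<open>snd y < 2 \<cdot> snd x\<close>.

  Distinctness in the last case is \<open>wr_block_products_distinct\<close>. The commutation defect with \<open>u\<close>
  (\<open>twist\<close>) is a cocycle that vanishes on the powers of \<open>u\<close>, so the defect of a product is a sum of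
  translates of the defect of \<open>v\<close>, one with a sign for each occurrence of \<open>v\<close> or its inverse. The
  blocks are chosen so that later translates never lie below the first one. The sign of the lowest
  nonzero coefficient then tells whether the first block is \<open>u\<^sup>e v\<close> or \<open>u v\<^sup>-\<^sup>1 u\<^sup>d v\<close>, and its
  position determines \<open>e\<close> or, once \<open>u v\<^sup>-\<^sup>1\<close> has been cancelled, \<open>d\<close>.
\<close>

section \<open>Word length\<close>

context group
begin

lemma word_length_word_value_le:
  assumes "finite_generating_set G S" "w \<in> lists (S \<times> UNIV)"
  shows "word_length G S (word_value G w) \<le> length w"
  using word_length_le_iff[OF assms(1) word_value_closed[OF _ assms(2)]] assms
  by (auto simp: finite_generating_set_def)

lemma word_of_word_length:
  assumes "finite_generating_set G S" "g \<in> carrier G"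
  obtains w where "w \<in> lists (S \<times> UNIV)" "length w \<le> word_length G S g" "word_value G w = g"
  using word_length_le_iff[OF assms, of "word_length G S g"] by blast

lemma word_length_mult_le:
  assumes S: "finite_generating_set G S" and "g \<in> carrier G" "h \<in> carrier G"
  shows "word_length G S (g \<otimes> h) \<le> word_length G S g + word_length G S h"
proof -
  obtain u v where u: "u \<in> lists (S \<times> UNIV)" "length u \<le> word_length G S g" "word_value G u = g"
    and v: "v \<in> lists (S \<times> UNIV)" "length v \<le> word_length G S h" "word_value G v = h"
    using word_of_word_length assms by metis
  have "word_value G (u @ v) = g \<otimes> h"
    using word_value_append[of S u v] S u v by (simp add: finite_generating_set_def)
  moreover have "u @ v \<in> lists (S \<times> UNIV)" using u v by simp
  ultimately have "word_length G S (g \<otimes> h) \<le> length (u @ v)"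
    using word_length_word_value_le[OF S] by metis
  then show ?thesis using u v by simp
qed

lemma word_value_word_inv:
  assumes "S \<subseteq> carrier G" "w \<in> lists (S \<times> UNIV)"
  shows "word_value G (word_inv w) = inv (word_value G w)"
  using assms(2)
proof (induction w)
  case Nil
  then show ?case by (simp add: word_value_def)
next
  case (Cons p w)
  obtain x b where p: "p = (x, b)" by (cases p)
  have x: "x \<in> S" "x \<in> carrier G" and w: "w \<in> lists (S \<times> UNIV)"
    using Cons.hyps p assms(1) by auto
  have letter: "word_value G [(x, b)] = (if b then x else inv x)" for b
    using x by (simp add: word_value_def)
  have "word_value G (word_inv (p # w)) = inv (word_value G w) \<otimes> (if b then inv x else x)"
    using word_value_append[OF assms(1) word_inv_in_lists[OF w], of "[(x, \<not> b)]"] x Cons.IH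
    by (simp add: p letter)
  moreover have "word_value G (p # w) = (if b then x else inv x) \<otimes> word_value G w"
    by (simp add: word_value_def p)
  ultimately show ?case
    using x word_value_closed[OF assms(1) w] by (simp add: inv_mult_group)
qed

lemma word_length_inv_le:
  assumes S: "finite_generating_set G S" and "g \<in> carrier G"
  shows "word_length G S (inv g) \<le> word_length G S g"
proof -
  obtain w where w: "w \<in> lists (S \<times> UNIV)" "length w \<le> word_length G S g" "word_value G w = g"
    using word_of_word_length assms by metis
  have "word_value G (word_inv w) = inv g"
    using word_value_word_inv[OF _ w(1)] w(3) S by (simp add: finite_generating_set_def)
  moreover have "length (word_inv w) = length w" by (simp add: word_inv_def)
  ultimately show ?thesis
    using word_length_word_value_le[OF S word_inv_in_lists[OF w(1)]] w by simp
qed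

lemma word_length_generator_le:
  assumes S: "finite_generating_set G S" and "s \<in> S"
  shows "word_length G S s \<le> 1"
  using word_length_word_value_le[OF S, of "[(s, True)]"] assms
  by (auto simp: word_value_def finite_generating_set_def subset_iff)

lemma word_length_one:
  assumes S: "finite_generating_set G S"
  shows "word_length G S \<one> = 0"
  using word_length_word_value_le[OF S, of "[]"] by (simp add: word_value_def)

lemma word_length_nat_pow_le:
  assumes S: "finite_generating_set G S" and g: "g \<in> carrier G"
  shows "word_length G S (g [^] (n :: nat)) \<le> n * word_length G S g"
proof (induction n)
  case 0
  then show ?case using word_length_one[OF S] by simp
next
  case (Suc n)
  then show ?case using word_length_mult_le[OF S nat_pow_closed[OF g, of n] g] by simp
qed

lemma word_length_int_pow_le:
  assumes S: "finite_generating_set G S" and g: "g \<in> carrier G"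
  shows "word_length G S (g [^] (e :: int)) \<le> nat \<bar>e\<bar> * word_length G S g"
proof (cases e rule: int_cases2)
  case (nonneg n)
  then show ?thesis using word_length_nat_pow_le[OF S g, of n] by (simp add: int_pow_int)
next
  case (nonpos n)
  then have "g [^] e = inv (g [^] n)" using g by (simp add: int_pow_neg int_pow_int)
  then show ?thesis
    using word_length_inv_le[OF S nat_pow_closed[OF g, of n]]
      word_length_nat_pow_le[OF S g, of n] nonpos by simp
qed

section \<open>Lower bounds for growth rates\<close>

lemma growth_rate_tendsto:
  assumes "finite_generating_set G S"
  shows "(\<lambda>n. root n (real (growth_function G S n))) \<longlonglongrightarrow> growth_rate G S"
  using convergent_growth[OF assms] unfolding growth_rate_def by (simp add: convergent_LIMSEQ_iff)

text \<open>The product of the blocks named by a list of indices.\<close>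

definition block_product :: "('i \<Rightarrow> 'a) \<Rightarrow> 'i list \<Rightarrow> 'a" where
  "block_product b L = foldr (\<lambda>i g. b i \<otimes> g) L \<one>"

lemma block_product_Nil [simp]: "block_product b [] = \<one>"
  by (simp add: block_product_def)

lemma block_product_Cons [simp]: "block_product b (i # L) = b i \<otimes> block_product b L"
  by (simp add: block_product_def)

lemma block_product_closed [simp]:
  "(\<And>i. b i \<in> carrier G) \<Longrightarrow> block_product b L \<in> carrier G"
  by (induction L) auto

lemma word_length_block_product_le:
  assumes S: "finite_generating_set G S" and b: "\<And>i. b i \<in> carrier G"
    and c: "\<And>i. word_length G S (b i) \<le> c i"
  shows "word_length G S (block_product b L) \<le> sum_list (map c L)"
proof (induction L)
  case Nil
  then show ?case using word_length_one[OF S] by simp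
next
  case (Cons i L)
  have "block_product b L \<in> carrier G" using b by simp
  from word_length_mult_le[OF S b[of i] this] show ?case using Cons c[of i] by simp
qed

text \<open>The generating function, in \<open>z\<close>, of the total cost of a list of \<open>k\<close> blocks.\<close>

lemma sum_lists_power:
  fixes z :: real
  assumes "finite E"
  shows "(\<Sum>L | set L \<subseteq> E \<and> length L = k. z ^ sum_list (map c L)) = (\<Sum>i\<in>E. z ^ c i) ^ k"
proof (induction k)
  case 0
  have "{L. set L \<subseteq> E \<and> length L = 0} = {[]}" by auto
  then show ?case by simp
next
  case (Suc k)
  let ?A = "{L. set L \<subseteq> E \<and> length L = k}"
  have "{L. set L \<subseteq> E \<and> length L = Suc k} = (\<lambda>(i, L). i # L) ` (E \<times> ?A)"
    by (auto simp: length_Suc_conv image_iff)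
  moreover have "inj_on (\<lambda>(i, L). i # L) (E \<times> ?A)" by (auto simp: inj_on_def)
  ultimately have "(\<Sum>L | set L \<subseteq> E \<and> length L = Suc k. z ^ sum_list (map c L)) =
      (\<Sum>(i, L)\<in>E \<times> ?A. z ^ c i * z ^ sum_list (map c L))"
    by (simp add: sum.reindex case_prod_unfold power_add)
  also have "\<dots> = (\<Sum>i\<in>E. z ^ c i) * (\<Sum>L\<in>?A. z ^ sum_list (map c L))"
    by (simp add: sum_product sum.cartesian_product)
  finally show ?case using Suc by simp
qed

text \<open>
  If the growth rate were below \<open>1 / z\<close>, then \<open>\<Sum> F(N) z\<^sup>N\<close> over \<open>N \<ge> k\<close>, with \<open>F\<close> the growth
  function, would be smaller than \<open>1\<close> for large \<open>k\<close>. But it dominates the total weight of the lists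
  of \<open>k\<close> blocks, which is at least \<open>1\<close>. Injectivity is needed only among lists of equal length.
\<close>

lemma growth_rate_ge_of_blocks:
  fixes z :: real and b :: "'i \<Rightarrow> 'a" and c :: "'i \<Rightarrow> nat"
  assumes S: "finite_generating_set G S" and b: "\<And>i. b i \<in> carrier G"
    and c: "\<And>i. word_length G S (b i) \<le> c i" and c_pos: "\<And>i. 1 \<le> c i"
    and inj: "\<And>L L'. length L = length L' \<Longrightarrow>
      block_product b L = block_product b L' \<Longrightarrow> L = L'"
    and E: "finite E" and z: "0 < z" and ge1: "1 \<le> (\<Sum>i\<in>E. z ^ c i)"
  shows "1 / z \<le> growth_rate G S"
proof (rule ccontr)
  let ?F = "\<lambda>n. real (growth_function G S n)"
  assume "\<not> 1 / z \<le> growth_rate G S"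
  then have "growth_rate G S < 1 / z" by simp
  then obtain y where y: "growth_rate G S < y" "y < 1 / z" using dense by blast
  have "eventually (\<lambda>n. root n (?F n) < y) sequentially"
    using order_tendstoD(2)[OF growth_rate_tendsto[OF S] y(1)] .
  then obtain n0 where n0: "root n (?F n) < y" if "n \<ge> n0" for n
    unfolding eventually_sequentially by blast
  have y0: "y > 0"
    using n0[of "Suc n0"] growth_function_pos[OF S, of "Suc n0"]
    by (meson lessI less_imp_le of_nat_0_less_iff order_less_trans real_root_gt_zero zero_less_Suc)
  have F_le: "?F n \<le> y ^ n" if "n \<ge> max 1 n0" for n
  proof -
    have "?F n = root n (?F n) ^ n" using that by (simp add: real_root_pow_pos2)
    also have "\<dots> \<le> y ^ n" using n0[of n] that by (intro power_mono) auto
    finally show ?thesis .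
  qed
  define q where "q = z * y"
  have q: "0 < q" "q < 1" using y z y0 by (auto simp: q_def field_simps)
  have "eventually (\<lambda>k. q ^ k < 1 - q) sequentially"
    using order_tendstoD(2)[OF LIMSEQ_power_zero[of q], of "1 - q"] q by simp
  then obtain k where k: "q ^ k < 1 - q" "k \<ge> max 1 n0"
    unfolding eventually_sequentially by (meson max.cobounded1 max.cobounded2 order.trans)
  let ?A = "{L. set L \<subseteq> E \<and> length L = k}" and ?c = "\<lambda>L. sum_list (map c L)"
  have finA: "finite ?A" using finite_lists_length_eq[OF E] .
  have ck: "?c L \<ge> length L" for L
    using c_pos by (induction L) (auto simp: add_mono[of 1 _ "length _", simplified])
  \<comment> \<open>The lists of total cost \<open>N\<close> inject into the ball of radius \<open>N\<close>.\<close>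
  have count: "real (card {L \<in> ?A. ?c L = N}) \<le> ?F N" for N
  proof -
    have "block_product b ` {L \<in> ?A. ?c L = N} \<subseteq> {g \<in> carrier G. word_length G S g \<le> N}"
      using word_length_block_product_le[OF S b c] b by fastforce
    moreover have "inj_on (block_product b) {L \<in> ?A. ?c L = N}"
      using inj by (auto simp: inj_on_def)
    ultimately show ?thesis
      using card_inj_on_le[OF _ _ finite_growth_ball[OF S]]
      unfolding growth_function_def of_nat_le_iff by blast
  qed
  define T where "T = ?c ` ?A"
  have finT: "finite T" using finA by (simp add: T_def)
  have kT: "k \<le> N" if N: "N \<in> T" for N
  proof -
    obtain L where "N = ?c L" "length L = k" using N by (auto simp: T_def)
    then show ?thesis using ck[of L] by simp
  qed
  have "1 \<le> (\<Sum>i\<in>E. z ^ c i) ^ k" using ge1 by simp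
  also have "\<dots> = (\<Sum>L\<in>?A. z ^ ?c L)" using sum_lists_power[OF E] by simp
  also have "\<dots> = (\<Sum>N\<in>T. \<Sum>L\<in>{L \<in> ?A. ?c L = N}. z ^ ?c L)"
    unfolding T_def by (rule sum.image_gen[OF finA])
  also have "\<dots> = (\<Sum>N\<in>T. real (card {L \<in> ?A. ?c L = N}) * z ^ N)" by simp
  also have "\<dots> \<le> (\<Sum>N\<in>T. q ^ N)"
  proof (rule sum_mono)
    fix N assume "N \<in> T"
    then have "N \<ge> max 1 n0" using kT k by (meson order.trans)
    then have "real (card {L \<in> ?A. ?c L = N}) \<le> y ^ N"
      using count[of N] F_le[of N] by linarith
    then show "real (card {L \<in> ?A. ?c L = N}) * z ^ N \<le> q ^ N"
      using mult_right_mono[of _ "y ^ N" "z ^ N"] z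
      by (simp add: q_def power_mult_distrib mult.commute[of "z ^ N"])
  qed
  also have "\<dots> \<le> (\<Sum>N\<in>{k..Max (insert k T)}. q ^ N)"
  proof (rule sum_mono2)
    show "T \<subseteq> {k..Max (insert k T)}" using kT finT by auto
  qed (use q in auto)
  also have "\<dots> \<le> q ^ k / (1 - q)"
  proof -
    have "(\<Sum>N\<in>{k..n}. q ^ N) \<le> q ^ k / (1 - q)" if "k \<le> n" for n
    proof -
      have "(\<Sum>N\<in>{k..n}. q ^ N) * (1 - q) = q ^ k - q ^ Suc n"
        using sum_gp_multiplied[OF that, of q] by (simp only: mult.commute)
      also have "\<dots> \<le> q ^ k" using q by simp
      finally show ?thesis using q by (simp add: pos_le_divide_eq)
    qed
    moreover have "k \<le> Max (insert k T)" using finT by simp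
    ultimately show ?thesis by blast
  qed
  also have "\<dots> < 1" using k q by (simp add: pos_divide_less_eq)
  finally show False by simp
qed

end

text \<open>Every \<open>z > \<surd>2 - 1\<close> satisfies \<open>z\<^sup>2 + 2 z > 1\<close>; here \<open>z = 1 / y\<close>.\<close>

lemma inverse_lt_silver:
  fixes y :: real
  assumes "1 < y" "y < 1 + sqrt 2"
  shows "1 < 2 * (1 / y) + (1 / y)\<^sup>2"
proof -
  have "(y - 1)\<^sup>2 < (sqrt 2)\<^sup>2" using assms by (intro power_strict_mono) auto
  then have "y\<^sup>2 < 2 * y + 1" by (simp add: power2_eq_square algebra_simps)
  then have "1 < (2 * y + 1) / y\<^sup>2" using assms by (simp add: pos_less_divide_eq)
  also have "\<dots> = 2 * (1 / y) + (1 / y)\<^sup>2"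
    using assms by (simp add: add_divide_distrib power2_eq_square)
  finally show ?thesis .
qed

lemma geometric_partial_sum_ge_one:
  fixes q A :: real
  assumes "0 \<le> q" "q < 1" "1 - q < A"
  shows "\<exists>M. 1 \<le> (\<Sum>j<M. A * q ^ j)"
proof -
  have "(\<lambda>j. A * q ^ j) sums (A * (1 / (1 - q)))"
    using assms by (intro sums_mult geometric_sums) simp
  then have "(\<lambda>M. \<Sum>j<M. A * q ^ j) \<longlonglongrightarrow> A / (1 - q)" by (simp add: sums_def)
  moreover have "1 < A / (1 - q)" using assms by (simp add: pos_less_divide_eq)
  ultimately have "eventually (\<lambda>M. 1 < (\<Sum>j<M. A * q ^ j)) sequentially"
    by (rule order_tendstoD)
  then show ?thesis by (meson eventually_sequentially less_imp_le order.refl)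
qed

text \<open>A window of \<open>2 M\<close> integers around \<open>k\<close>, paired by the reflection \<open>e \<mapsto> 2 k - 1 - e\<close>.\<close>

lemma sum_int_halves:
  fixes f :: "int \<Rightarrow> real" and k :: int
  defines "E \<equiv> \<lambda>M. (\<lambda>j. k + int j) ` {..<M} \<union> (\<lambda>j. k - 1 - int j) ` {..<M}"
  shows "sum f (E M) = (\<Sum>j<M. f (k + int j) + f (k - 1 - int j))" "finite (E M)"
proof -
  have "(\<lambda>j. k + int j) ` {..<M} \<inter> (\<lambda>j. k - 1 - int j) ` {..<M} = {}" by auto
  then have "sum f (E M) =
      sum f ((\<lambda>j. k + int j) ` {..<M}) + sum f ((\<lambda>j. k - 1 - int j) ` {..<M})"
    unfolding E_def by (intro sum.union_disjoint) auto
  also have "\<dots> = (\<Sum>j<M. f (k + int j)) + (\<Sum>j<M. f (k - 1 - int j))"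
    by (simp add: sum.reindex inj_on_def)
  finally show "sum f (E M) = (\<Sum>j<M. f (k + int j) + f (k - 1 - int j))"
    by (simp add: sum.distrib)
qed (simp add: E_def)

lemma linear_cost_sum_ge_one:
  fixes y :: real
  assumes y: "1 < y" "y < 1 + sqrt 2"
  shows "\<exists>E :: int set. finite E \<and> 1 \<le> (\<Sum>e\<in>E. (1 / y) ^ (nat \<bar>e\<bar> + 1))"
proof -
  define z where "z = 1 / y"
  have z: "0 < z" "z < 1" using y by (auto simp: z_def)
  have "1 - z < z + z\<^sup>2"
    using inverse_lt_silver[OF y] unfolding z_def by linarith
  then obtain M where M: "1 \<le> (\<Sum>j<M. (z + z\<^sup>2) * z ^ j)"
    using geometric_partial_sum_ge_one[of z "z + z\<^sup>2"] z by auto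
  have "z ^ (nat \<bar>0 + int j\<bar> + 1) + z ^ (nat \<bar>0 - 1 - int j\<bar> + 1) = (z + z\<^sup>2) * z ^ j" for j
  proof -
    have "nat \<bar>0 + int j\<bar> + 1 = j + 1" "nat \<bar>0 - 1 - int j\<bar> + 1 = j + 2" by auto
    then show ?thesis by (simp add: power2_eq_square algebra_simps)
  qed
  then show ?thesis
    using sum_int_halves(1)[where k = 0 and M = M and f = "\<lambda>e. z ^ (nat \<bar>e\<bar> + 1)"]
      sum_int_halves(2)[where k = 0 and M = M] M
    unfolding z_def[symmetric] by (intro exI conjI) (assumption, simp only: order.refl)
qed

lemma odd_cost_sum_ge_one:
  fixes y :: real
  assumes y: "1 < y" "y < 1 + sqrt 2"
  shows "\<exists>E :: int set. finite E \<and> 1 \<le> (\<Sum>e\<in>E. (1 / y) ^ nat \<bar>2 * e - 1\<bar>)"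
proof -
  define z where "z = 1 / y"
  have z: "0 < z" "z < 1" using y by (auto simp: z_def)
  have "1 - z\<^sup>2 < 2 * z"
    using inverse_lt_silver[OF y] unfolding z_def by linarith
  moreover have "z\<^sup>2 < 1" using z by (simp add: power_less_one_iff)
  ultimately obtain M where M: "1 \<le> (\<Sum>j<M. 2 * z * (z\<^sup>2) ^ j)"
    using geometric_partial_sum_ge_one[of "z\<^sup>2" "2 * z"] z by auto
  have "z ^ nat \<bar>2 * (1 + int j) - 1\<bar> + z ^ nat \<bar>2 * (1 - 1 - int j) - 1\<bar> = 2 * z * (z\<^sup>2) ^ j" for j
  proof -
    have "nat \<bar>2 * (1 + int j) - 1\<bar> = 2 * j + 1" "nat \<bar>2 * (1 - 1 - int j) - 1\<bar> = 2 * j + 1" by auto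
    then show ?thesis by (simp add: power_mult)
  qed
  then show ?thesis
    using sum_int_halves(1)[where k = 1 and M = M and f = "\<lambda>e. z ^ nat \<bar>2 * e - 1\<bar>"]
      sum_int_halves(2)[where k = 1 and M = M] M
    unfolding z_def[symmetric] by (intro exI conjI) (assumption, simp only: order.refl)
qed

lemma (in group) growth_rate_ge_silver:
  fixes b :: "int \<Rightarrow> 'a"
  assumes S: "finite_generating_set G S" and b: "\<And>e. b e \<in> carrier G"
    and inj: "\<And>L L'. length L = length L' \<Longrightarrow>
      block_product b L = block_product b L' \<Longrightarrow> L = L'"
    and len: "(\<forall>e. word_length G S (b e) \<le> nat \<bar>e\<bar> + 1) \<or>
      (\<forall>e. word_length G S (b e) \<le> nat \<bar>2 * e - 1\<bar>)"
  shows "1 + sqrt 2 \<le> growth_rate G S"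
proof (rule dense_le_bounded)
  show "1 < 1 + sqrt (2 :: real)" by simp
  fix y :: real assume y: "1 < y" "y < 1 + sqrt 2"
  from len obtain c E where c: "\<And>e. word_length G S (b e) \<le> c e" "\<And>e. 1 \<le> c e"
    and E: "finite E" "1 \<le> (\<Sum>e\<in>E. (1 / y) ^ c e)"
  proof
    assume "\<forall>e. word_length G S (b e) \<le> nat \<bar>e\<bar> + 1"
    with linear_cost_sum_ge_one[OF y] that[of "\<lambda>e. nat \<bar>e\<bar> + 1"] show thesis by auto
  next
    assume len: "\<forall>e. word_length G S (b e) \<le> nat \<bar>2 * e - 1\<bar>"
    have "1 \<le> nat \<bar>2 * e - 1\<bar>" for e
    proof -
      have "2 * e - 1 \<noteq> 0" by presburger
      then show ?thesis by simp
    qed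
    with len odd_cost_sum_ge_one[OF y] that[of "\<lambda>e. nat \<bar>2 * e - 1\<bar>"] show thesis by blast
  qed
  have "1 / (1 / y) \<le> growth_rate G S"
  proof (rule growth_rate_ge_of_blocks[where b = b and c = c and E = E])
    show "0 < 1 / y" using y by simp
  qed (fact S b c inj E)+
  then show "y \<le> growth_rate G S" by simp
qed

section \<open>The commutation defect as a cocycle\<close>

abbreviation wr_mult :: "(int \<Rightarrow> int) \<times> int \<Rightarrow> (int \<Rightarrow> int) \<times> int \<Rightarrow> (int \<Rightarrow> int) \<times> int"
    (infixl "\<cdot>" 70) where
  "x \<cdot> y \<equiv> x \<otimes>\<^bsub>Z_wr_Z\<^esub> y"

lemma fst_wr_mult [simp]: "fst (x \<cdot> y) i = fst x i + fst y (i - snd x)"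
  by (cases x; cases y) (simp add: mult_Z_wr_Z)

lemma snd_wr_mult [simp]: "snd (x \<cdot> y) = snd x + snd y"
  by (cases x; cases y) (simp add: mult_Z_wr_Z)

lemma snd_wr_inv:
  assumes "x \<in> carrier Z_wr_Z"
  shows "snd (inv\<^bsub>Z_wr_Z\<^esub> x) = - snd x"
proof -
  have "snd (x \<cdot> inv\<^bsub>Z_wr_Z\<^esub> x) = 0" using assms by (simp add: one_Z_wr_Z del: snd_wr_mult)
  then show ?thesis by simp
qed

lemma snd_wr_int_pow:
  assumes "x \<in> carrier Z_wr_Z"
  shows "snd (x [^]\<^bsub>Z_wr_Z\<^esub> (e :: int)) = e * snd x"
proof -
  have nat: "snd (x [^]\<^bsub>Z_wr_Z\<^esub> n) = int n * snd x" for n :: nat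
    by (induction n) (simp_all add: one_Z_wr_Z algebra_simps)
  show ?thesis
    using assms by (cases e rule: int_cases2)
      (simp_all add: nat int_pow_int Z_wr_Z.int_pow_neg snd_wr_inv)
qed

text \<open>
  The lamp part of the defect between \<open>h u\<close> and \<open>u h\<close>. As a function of \<open>h\<close> it is a cocycle for the
  translation action through \<open>snd\<close>; it vanishes identically exactly when \<open>h\<close> commutes with \<open>u\<close>.
\<close>

definition twist :: "(int \<Rightarrow> int) \<times> int \<Rightarrow> (int \<Rightarrow> int) \<times> int \<Rightarrow> int \<Rightarrow> int" where
  "twist u h i = fst (h \<cdot> u) i - fst (u \<cdot> h) i"

lemma twist_mult: "twist u (g \<cdot> h) i = twist u g i + twist u h (i - snd g)"
  by (simp add: twist_def algebra_simps)

lemma twist_one [simp]: "twist u \<one>\<^bsub>Z_wr_Z\<^esub> i = 0"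
  by (simp add: twist_def one_Z_wr_Z)

lemma twist_inv:
  assumes "v \<in> carrier Z_wr_Z"
  shows "twist u (inv\<^bsub>Z_wr_Z\<^esub> v) i = - twist u v (i + snd v)"
proof -
  have "twist u (v \<cdot> inv\<^bsub>Z_wr_Z\<^esub> v) (i + snd v) = 0"
    using assms by simp
  then show ?thesis unfolding twist_mult by simp
qed

lemma twist_int_pow [simp]:
  assumes "u \<in> carrier Z_wr_Z"
  shows "twist u (u [^]\<^bsub>Z_wr_Z\<^esub> (e :: int)) i = 0"
proof -
  have "u [^]\<^bsub>Z_wr_Z\<^esub> e \<cdot> u = u \<cdot> u [^]\<^bsub>Z_wr_Z\<^esub> e"
    using Z_wr_Z.int_pow_mult[OF assms, of e 1] Z_wr_Z.int_pow_mult[OF assms, of 1 e] assms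
    by (simp add: add.commute Z_wr_Z.int_pow_1)
  then show ?thesis by (simp add: twist_def del: fst_wr_mult)
qed

lemma lowest_nonzero:
  fixes F :: "int \<Rightarrow> int"
  assumes "finite {i. F i \<noteq> 0}" "F i \<noteq> 0"
  obtains s where "F s \<noteq> 0" "\<And>i. i < s \<Longrightarrow> F i = 0"
proof
  show "F (Min {i. F i \<noteq> 0}) \<noteq> 0" using Min_in[OF assms(1)] assms(2) by auto
  show "F i = 0" if "i < Min {i. F i \<noteq> 0}" for i
    using that Min_le[OF assms(1), of i] by fastforce
qed

lemma finite_support_fst: "x \<in> carrier Z_wr_Z \<Longrightarrow> finite {i. fst x i \<noteq> 0}"
  by (auto simp: carrier_Z_wr_Z)

lemma lowest_twist:
  assumes u: "u \<in> carrier Z_wr_Z" and v: "v \<in> carrier Z_wr_Z" and "u \<cdot> v \<noteq> v \<cdot> u"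
  obtains s where "twist u v s \<noteq> 0" "\<And>i. i < s \<Longrightarrow> twist u v i = 0"
proof -
  have "finite ({i. fst (v \<cdot> u) i \<noteq> 0} \<union> {i. fst (u \<cdot> v) i \<noteq> 0})"
    unfolding finite_Un by (intro conjI finite_support_fst Z_wr_Z.m_closed u v)
  then have "finite {i. twist u v i \<noteq> 0}"
    by (rule rev_finite_subset) (auto simp: twist_def)
  moreover have "\<exists>i. twist u v i \<noteq> 0"
  proof (rule ccontr)
    assume "\<nexists>i. twist u v i \<noteq> 0"
    then have "fst (u \<cdot> v) = fst (v \<cdot> u)" by (auto simp: twist_def)
    then show False using assms(3) by (simp add: prod_eq_iff)
  qed
  ultimately show thesis using lowest_nonzero that by metis
qed

section \<open>Blocks with distinct products\<close>

text \<open>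
  The block with index \<open>e\<close> is \<open>u\<^sup>e v\<close> for \<open>e \<ge> -K\<close>; the remaining indices \<open>e = -K - d\<close> with \<open>d \<ge> 1\<close>
  are used for \<open>u v\<^sup>-\<^sup>1 u\<^sup>d v\<close>.
\<close>

definition wr_block ::
    "(int \<Rightarrow> int) \<times> int \<Rightarrow> (int \<Rightarrow> int) \<times> int \<Rightarrow> int \<Rightarrow> int \<Rightarrow> (int \<Rightarrow> int) \<times> int" where
  "wr_block u v K e =
     (if - K \<le> e then u [^]\<^bsub>Z_wr_Z\<^esub> e \<cdot> v
      else u \<cdot> inv\<^bsub>Z_wr_Z\<^esub> v \<cdot> (u [^]\<^bsub>Z_wr_Z\<^esub> (- e - K) \<cdot> v))"

lemma wr_block_closed:
  assumes "u \<in> carrier Z_wr_Z" "v \<in> carrier Z_wr_Z"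
  shows "wr_block u v K e \<in> carrier Z_wr_Z"
  using assms by (simp add: wr_block_def)

text \<open>
  Relative to the start of a product, the previous \<open>v\<close> contributed its defect translated by
  \<open>- snd v\<close>. In \<open>u\<^sup>e v\<close> the new defect is translated by \<open>e \<cdot> snd u \<ge> - snd v\<close>, with the same sign
  if the two coincide; in \<open>u v\<^sup>-\<^sup>1 u\<^sup>d v\<close> the first new defect is negative and translated by
  \<open>snd u - snd v > - snd v\<close>. So nothing cancels the lowest term contributed by the first block.
\<close>

lemma wr_block_products_distinct:
  assumes u: "u \<in> carrier Z_wr_Z" and v: "v \<in> carrier Z_wr_Z"
    and nc: "u \<cdot> v \<noteq> v \<cdot> u" and pos: "0 < snd u" and K: "K * snd u \<le> snd v"
    and "length L = length L'"
    and "Z_wr_Z.block_product (wr_block u v K) L = Z_wr_Z.block_product (wr_block u v K) L'"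
  shows "L = L'"
proof -
  let ?pow = "\<lambda>e :: int. u [^]\<^bsub>Z_wr_Z\<^esub> e"
  let ?P = "Z_wr_Z.block_product (wr_block u v K)"
  obtain s where s: "twist u v s \<noteq> 0" "\<And>i. i < s \<Longrightarrow> twist u v i = 0"
    using lowest_twist[OF u v nc] by blast
  \<comment> \<open>Normalised so that the lowest coefficient of the defect of \<open>v\<close> is positive.\<close>
  define \<Phi> where "\<Phi> h i = sgn (twist u v s) * twist u h i" for h i
  \<comment> \<open>What may follow an occurrence of \<open>v\<close> without hiding its lowest term.\<close>
  define tame where
    "tame h \<longleftrightarrow> (\<forall>i < s - snd v. \<Phi> h i = 0) \<and> 0 \<le> \<Phi> h (s - snd v)" for h
  have Phi_mult: "\<Phi> (g \<cdot> h) i = \<Phi> g i + \<Phi> h (i - snd g)" for g h i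
    by (simp add: \<Phi>_def twist_mult algebra_simps)
  have Phi_v: "0 < \<Phi> v s" "\<And>i. i < s \<Longrightarrow> \<Phi> v i = 0"
    using s by (auto simp: \<Phi>_def mult.commute simp flip: abs_sgn)
  have Phi_u: "\<Phi> (?pow e) i = 0" for e i using u by (simp add: \<Phi>_def)
  have Phi_plus: "\<Phi> (?pow e \<cdot> v \<cdot> h) i = \<Phi> v (i - e * snd u) + \<Phi> h (i - e * snd u - snd v)"
    for e h i
    using u by (simp add: Phi_mult Phi_u snd_wr_int_pow algebra_simps)
  have Phi_minus: "\<Phi> (u \<cdot> inv\<^bsub>Z_wr_Z\<^esub> v \<cdot> h) i =
      - \<Phi> v (i - snd u + snd v) + \<Phi> h (i - snd u + snd v)" for h i
    using u v Phi_u[of 1] 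
    by (simp add: Phi_mult snd_wr_inv Z_wr_Z.int_pow_1) (simp add: \<Phi>_def twist_inv algebra_simps)
  have plus: "(\<forall>i < s + e * snd u. \<Phi> (?pow e \<cdot> v \<cdot> h) i = 0) \<and>
      0 < \<Phi> (?pow e \<cdot> v \<cdot> h) (s + e * snd u)" if "tame h" for e h
    using that Phi_v unfolding Phi_plus tame_def by auto
  have minus: "(\<forall>i < s + snd u - snd v. \<Phi> (u \<cdot> inv\<^bsub>Z_wr_Z\<^esub> v \<cdot> (?pow d \<cdot> v \<cdot> h)) i = 0) \<and>
      \<Phi> (u \<cdot> inv\<^bsub>Z_wr_Z\<^esub> v \<cdot> (?pow d \<cdot> v \<cdot> h)) (s + snd u - snd v) < 0"
    if "tame h" "d \<ge> 1" for d h
  proof -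
    have "0 < d * snd u" using that pos by simp
    then have "\<Phi> (?pow d \<cdot> v \<cdot> h) i = 0" if "i \<le> s" for i using plus[OF \<open>tame h\<close>, of d] that by simp
    then show ?thesis using Phi_v unfolding Phi_minus by simp
  qed
  have plus_inj: "e = e'" if "tame h" "tame h'" "?pow e \<cdot> v \<cdot> h = ?pow e' \<cdot> v \<cdot> h'" for e e' h h'
  proof -
    have "s + e * snd u = s + e' * snd u"
      using plus[OF that(1), of e] plus[OF that(2), of e'] unfolding that(3)
      by (metis linorder_cases order_less_irrefl)
    then show ?thesis using pos by simp
  qed
  have closed: "?P L \<in> carrier Z_wr_Z" for L
    using wr_block_closed[OF u v] by simp
  have assoc: "wr_block u v K e \<cdot> h = (if - K \<le> e then ?pow e \<cdot> v \<cdot> h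
      else u \<cdot> inv\<^bsub>Z_wr_Z\<^esub> v \<cdot> (?pow (- e - K) \<cdot> v \<cdot> h))" if "h \<in> carrier Z_wr_Z" for e h
    using u v that by (simp add: wr_block_def Z_wr_Z.m_assoc)
  have tame: "tame (?P L)" for L
  proof (induction L)
    case Nil
    then show ?case by (simp add: tame_def \<Phi>_def)
  next
    case (Cons e L)
    show ?case
    proof (cases "- K \<le> e")
      case True
      then have "- K * snd u \<le> e * snd u" using pos by (intro mult_right_mono) auto
      then have le: "s - snd v \<le> s + e * snd u" using K by simp
      let ?g = "?pow e \<cdot> v \<cdot> ?P L"
      have low: "\<forall>i < s + e * snd u. \<Phi> ?g i = 0" and lead: "0 < \<Phi> ?g (s + e * snd u)"
        using plus[OF Cons, of e] by auto
      have "0 \<le> \<Phi> ?g (s - snd v)"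
      proof (cases "s - snd v = s + e * snd u")
        case True
        show ?thesis unfolding True using lead by simp
      next
        case False
        then have "s - snd v < s + e * snd u" using le by simp
        then show ?thesis using low by simp
      qed
      moreover have "\<forall>i < s - snd v. \<Phi> ?g i = 0" using low le by auto
      ultimately have "tame ?g" by (simp add: tame_def)
      then show ?thesis using True by (simp add: assoc[OF closed])
    next
      case False
      then show ?thesis
        using minus[OF Cons, of "- e - K"] pos by (auto simp: assoc[OF closed] tame_def)
    qed
  qed
  show ?thesis using assms(6,7)
  proof (induction L L' rule: list_induct2)
    case Nil
    show ?case ..
  next
    case (Cons e L e' L')
    have eq: "wr_block u v K e \<cdot> ?P L = wr_block u v K e' \<cdot> ?P L'"
      using Cons.prems by simp
    have "e = e'"
    proof (cases "- K \<le> e \<longleftrightarrow> - K \<le> e'")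
      case same: True
      show ?thesis
      proof (cases "- K \<le> e")
        case True
        then show ?thesis using plus_inj[OF tame tame] eq same by (simp add: assoc[OF closed])
      next
        case False
        then have "u \<cdot> inv\<^bsub>Z_wr_Z\<^esub> v \<cdot> (?pow (- e - K) \<cdot> v \<cdot> ?P L) =
            u \<cdot> inv\<^bsub>Z_wr_Z\<^esub> v \<cdot> (?pow (- e' - K) \<cdot> v \<cdot> ?P L')"
          using eq same by (simp add: assoc[OF closed])
        \<comment> \<open>After cancelling \<open>u v\<^sup>-\<^sup>1\<close> this is the comparison of two blocks of the first kind.\<close>
        then have "?pow (- e - K) \<cdot> v \<cdot> ?P L = ?pow (- e' - K) \<cdot> v \<cdot> ?P L'"
          using u v closed by (subst (asm) Z_wr_Z.Units_l_cancel) simp_all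
        then show ?thesis using plus_inj[OF tame tame] by fastforce
      qed
    next
      case False
      \<comment> \<open>The lowest coefficients of blocks of the two kinds have opposite signs.\<close>
      have clash: False if "tame h" "tame h'" "- d - K \<ge> 1"
        "?pow c \<cdot> v \<cdot> h = u \<cdot> inv\<^bsub>Z_wr_Z\<^esub> v \<cdot> (?pow (- d - K) \<cdot> v \<cdot> h')" for c d h h'
        using plus[OF that(1), of c] minus[OF that(2,3)] unfolding that(4)
        by (metis linorder_cases order_less_irrefl order_less_asym)
      show ?thesis
        using False eq clash[OF tame tame, of e' e L L'] clash[OF tame tame, of e e' L' L]
        by (cases "- K \<le> e") (auto simp: assoc[OF closed])
    qed
    moreover have "?P L = ?P L'"
      using eq \<open>e = e'\<close> closed wr_block_closed[OF u v] by (simp add: Z_wr_Z.Units_l_cancel)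
    ultimately show ?case using Cons.IH by simp
  qed
qed

lemma wr_base_int_pow:
  assumes "u \<in> carrier Z_wr_Z" "snd u = 0"
  shows "fst (u [^]\<^bsub>Z_wr_Z\<^esub> (e :: int)) i = e * fst u i"
proof -
  have nat: "fst (u [^]\<^bsub>Z_wr_Z\<^esub> n) i = int n * fst u i" for n :: nat
  proof (induction n)
    case (Suc n)
    have "snd (u [^]\<^bsub>Z_wr_Z\<^esub> n) = 0"
      using snd_wr_int_pow[OF assms(1), of "int n"] assms(2) by (simp add: int_pow_int)
    then show ?case using Suc by (simp add: algebra_simps)
  qed (simp add: one_Z_wr_Z)
  have "fst (inv\<^bsub>Z_wr_Z\<^esub> (u [^]\<^bsub>Z_wr_Z\<^esub> n)) i = - fst (u [^]\<^bsub>Z_wr_Z\<^esub> n) i" for n :: nat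
  proof -
    have "fst (u [^]\<^bsub>Z_wr_Z\<^esub> n \<cdot> inv\<^bsub>Z_wr_Z\<^esub> (u [^]\<^bsub>Z_wr_Z\<^esub> n)) i = 0"
      using assms by (simp add: one_Z_wr_Z del: fst_wr_mult)
    moreover have "snd (u [^]\<^bsub>Z_wr_Z\<^esub> n) = 0"
      using snd_wr_int_pow[OF assms(1), of "int n"] assms(2) by (simp add: int_pow_int)
    ultimately show ?thesis by simp
  qed
  then show ?thesis
    using assms by (cases e rule: int_cases2) (simp_all add: nat int_pow_int Z_wr_Z.int_pow_neg)
qed

text \<open>
  For \<open>snd u = 0\<close> the contributions of \<open>v\<close> depend only on the number of blocks, and the lowest lamp
  of \<open>u\<close> is affected only by the first block.
\<close>

lemma base_block_products_distinct:
  assumes u: "u \<in> carrier Z_wr_Z" and v: "v \<in> carrier Z_wr_Z"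
    and u0: "snd u = 0" and "u \<noteq> \<one>\<^bsub>Z_wr_Z\<^esub>" and pos: "0 < snd v"
    and "length L = length L'"
    and "Z_wr_Z.block_product (\<lambda>e. u [^]\<^bsub>Z_wr_Z\<^esub> e \<cdot> v) L =
      Z_wr_Z.block_product (\<lambda>e. u [^]\<^bsub>Z_wr_Z\<^esub> (e :: int) \<cdot> v) L'"
  shows "L = L'"
proof -
  let ?pow = "\<lambda>e :: int. u [^]\<^bsub>Z_wr_Z\<^esub> e"
  let ?P = "Z_wr_Z.block_product (\<lambda>e. ?pow e \<cdot> v)"
  have "\<exists>i. fst u i \<noteq> 0" using assms(3,4) by (auto simp: one_Z_wr_Z prod_eq_iff)
  then obtain s where s: "fst u s \<noteq> 0" "\<And>i. i < s \<Longrightarrow> fst u i = 0"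
    using lowest_nonzero[OF finite_support_fst[OF u]] by metis
  have step: "fst (?pow e \<cdot> v \<cdot> h) i = e * fst u i + fst v i + fst h (i - snd v)" for e h i
    using u u0 by (simp add: wr_base_int_pow snd_wr_int_pow)
  have low: "fst (?P L) i = fst (?P L') i" if "length L = length L'" "i < s" for L L' i
    using that
  proof (induction L L' arbitrary: i rule: list_induct2)
    case (Cons e L e' L')
    then have "fst (?P L) (i - snd v) = fst (?P L') (i - snd v)" using pos by simp
    then show ?case using s(2) Cons.prems by (simp add: step del: fst_wr_mult)
  qed simp
  show ?thesis using assms(6,7)
  proof (induction L L' rule: list_induct2)
    case (Cons e L e' L')
    have closed: "?P L \<in> carrier Z_wr_Z" for L using u v by simp
    have eq: "?pow e \<cdot> v \<cdot> ?P L = ?pow e' \<cdot> v \<cdot> ?P L'" using Cons.prems by simp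
    then have "fst (?pow e \<cdot> v \<cdot> ?P L) s = fst (?pow e' \<cdot> v \<cdot> ?P L') s" by simp
    moreover have "fst (?P L) (s - snd v) = fst (?P L') (s - snd v)"
      using low[OF Cons.hyps] pos by simp
    ultimately have "e = e'" unfolding step using s(1) by simp
    moreover have "?P L = ?P L'"
      using eq \<open>e = e'\<close> closed u v by (simp add: Z_wr_Z.Units_l_cancel)
    ultimately show ?case using Cons.IH by simp
  qed simp
qed

section \<open>All finite generating sets of the wreath product\<close>

lemma (in group) commute_inv:
  assumes "h \<in> carrier G" "g \<in> carrier G" "h \<otimes> g = g \<otimes> h"
  shows "inv h \<otimes> g = g \<otimes> inv h"
proof -
  have "inv h \<otimes> g = inv h \<otimes> (g \<otimes> h) \<otimes> inv h" using assms(1,2) by (simp add: m_assoc)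
  also have "\<dots> = inv h \<otimes> (h \<otimes> g) \<otimes> inv h" using assms(3) by simp
  also have "\<dots> = g \<otimes> inv h" using assms(1,2) by (simp add: m_assoc[symmetric])
  finally show ?thesis .
qed

lemma (in group) commute_generate:
  assumes S: "S \<subseteq> carrier G" and g: "g \<in> carrier G"
    and comm: "\<And>s. s \<in> S \<Longrightarrow> s \<otimes> g = g \<otimes> s" and h: "h \<in> generate G S"
  shows "h \<otimes> g = g \<otimes> h"
  using h
proof induction
  case one
  show ?case using g by simp
next
  case (incl h)
  then show ?case by (rule comm)
next
  case (inv h)
  then show ?case using S g comm by (intro commute_inv) auto
next
  case (eng h k)
  then have "h \<in> carrier G" "k \<in> carrier G" using generate_in_carrier[OF S] by auto
  then show ?case using eng.IH g by (metis m_assoc)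
qed

lemma exists_noncommuting_generators:
  assumes S: "S \<subseteq> carrier Z_wr_Z" and gen: "generate Z_wr_Z S = carrier Z_wr_Z"
  obtains x y where "x \<in> S" "y \<in> S" "x \<cdot> y \<noteq> y \<cdot> x"
proof -
  have "x \<cdot> y = y \<cdot> x" if comm: "\<forall>x\<in>S. \<forall>y\<in>S. x \<cdot> y = y \<cdot> x"
    and x: "x \<in> carrier Z_wr_Z" and y: "y \<in> carrier Z_wr_Z" for x y
  proof -
    have "h \<cdot> s = s \<cdot> h" if "s \<in> S" "h \<in> carrier Z_wr_Z" for s h
      using Z_wr_Z.commute_generate[OF S, of s h] S comm that gen by auto
    then show ?thesis
      using Z_wr_Z.commute_generate[OF S y, of x] x y gen by auto
  qed
  moreover have "gen_a \<cdot> gen_t \<noteq> gen_t \<cdot> gen_a"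
  proof
    assume "gen_a \<cdot> gen_t = gen_t \<cdot> gen_a"
    then have "fst (gen_a \<cdot> gen_t) 0 = fst (gen_t \<cdot> gen_a) 0" by simp
    then show False by (simp add: gen_a_def gen_t_def)
  qed
  ultimately show thesis using that gens_in_carrier by blast
qed

lemma exists_generator_snd_nonzero:
  assumes S: "S \<subseteq> carrier Z_wr_Z" and gen: "generate Z_wr_Z S = carrier Z_wr_Z"
  obtains x where "x \<in> S" "snd x \<noteq> 0"
proof -
  have "snd h = 0" if all: "\<forall>s\<in>S. snd s = 0" and h: "h \<in> generate Z_wr_Z S" for h
    using h
  proof induction
    case (inv s)
    then have "s \<in> carrier Z_wr_Z" "snd s = 0" using all S by auto
    then show ?case by (simp add: snd_wr_inv)
  qed (use all in \<open>simp_all add: one_Z_wr_Z\<close>)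
  moreover have "gen_t \<in> generate Z_wr_Z S" using gens_in_carrier gen by simp
  moreover have "snd gen_t = 1" by (simp add: gen_t_def)
  ultimately have "\<not> (\<forall>s\<in>S. snd s = 0)" by fastforce
  then show thesis using that by blast
qed

lemma growth_rate_ge_of_base_generator:
  assumes S: "finite_generating_set Z_wr_Z S"
    and s: "s \<in> carrier Z_wr_Z" "word_length Z_wr_Z S s \<le> 1" "snd s = 0" "s \<noteq> \<one>\<^bsub>Z_wr_Z\<^esub>"
    and x: "x \<in> carrier Z_wr_Z" "word_length Z_wr_Z S x \<le> 1" "0 < snd x"
  shows "1 + sqrt 2 \<le> growth_rate Z_wr_Z S"
proof (rule Z_wr_Z.growth_rate_ge_silver[OF S, where b = "\<lambda>e. s [^]\<^bsub>Z_wr_Z\<^esub> e \<cdot> x"])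
  show "s [^]\<^bsub>Z_wr_Z\<^esub> e \<cdot> x \<in> carrier Z_wr_Z" for e :: int using s x by simp
  have "word_length Z_wr_Z S (s [^]\<^bsub>Z_wr_Z\<^esub> e \<cdot> x) \<le> nat \<bar>e\<bar> + 1" for e :: int
  proof -
    have "word_length Z_wr_Z S (s [^]\<^bsub>Z_wr_Z\<^esub> e) \<le> nat \<bar>e\<bar>"
      using Z_wr_Z.word_length_int_pow_le[OF S s(1), of e] mult_le_mono2[OF s(2), of "nat \<bar>e\<bar>"]
      by linarith
    moreover have "s [^]\<^bsub>Z_wr_Z\<^esub> e \<in> carrier Z_wr_Z" using s by simp
    ultimately show ?thesis
      using Z_wr_Z.word_length_mult_le[OF S _ x(1), of "s [^]\<^bsub>Z_wr_Z\<^esub> e"] x(2) by simp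
  qed
  then show "(\<forall>e. word_length Z_wr_Z S (s [^]\<^bsub>Z_wr_Z\<^esub> e \<cdot> x) \<le> nat \<bar>e\<bar> + 1) \<or>
      (\<forall>e. word_length Z_wr_Z S (s [^]\<^bsub>Z_wr_Z\<^esub> e \<cdot> x) \<le> nat \<bar>2 * e - 1\<bar>)" by blast
qed (rule base_block_products_distinct[OF s(1) x(1) s(3,4) x(3)])

text \<open>
  The length of \<open>u x\<^sup>-\<^sup>1 u\<^sup>d x\<close> with \<open>u = y x\<^sup>-\<^sup>1\<close> is at most \<open>2 d + 2\<close>, below the permitted
  \<open>2 d + 3\<close> for the index \<open>-1 - d\<close>; the length of \<open>x y\<^sup>-\<^sup>1 x\<^sup>d y\<close> is at most \<open>d + 3\<close>, exactly the
  permitted value for the index \<open>-2 - d\<close>.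
\<close>

lemma growth_rate_ge_of_noncommuting:
  assumes S: "finite_generating_set Z_wr_Z S"
    and x: "x \<in> carrier Z_wr_Z" "word_length Z_wr_Z S x \<le> 1"
    and y: "y \<in> carrier Z_wr_Z" "word_length Z_wr_Z S y \<le> 1"
    and nc: "x \<cdot> y \<noteq> y \<cdot> x" and pos: "0 < snd x" and le: "snd x \<le> snd y"
  shows "1 + sqrt 2 \<le> growth_rate Z_wr_Z S"
proof -
  let ?wl = "word_length Z_wr_Z S"
  let ?inv = "\<lambda>g. inv\<^bsub>Z_wr_Z\<^esub> g"
  let ?pow = "\<lambda>g (e :: int). g [^]\<^bsub>Z_wr_Z\<^esub> e"
  note mult_le = Z_wr_Z.word_length_mult_le[OF S]
  define u where "u = y \<cdot> ?inv x"
  have u: "u \<in> carrier Z_wr_Z" using x y by (simp add: u_def)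
  have ux: "u \<cdot> x = y" using x y by (simp add: u_def Z_wr_Z.m_assoc)
  have wl_inv: "?wl (?inv x) \<le> 1" "?wl (?inv y) \<le> 1"
    using Z_wr_Z.word_length_inv_le[OF S x(1)] Z_wr_Z.word_length_inv_le[OF S y(1)] x(2) y(2)
    by auto
  have wl_u: "?wl u \<le> 2"
    using mult_le[OF y(1) Z_wr_Z.inv_closed[OF x(1)]] wl_inv y(2) unfolding u_def by linarith
  have wl_pow_u: "?wl (?pow u e) \<le> nat \<bar>e\<bar> * 2" for e
    using Z_wr_Z.word_length_int_pow_le[OF S u, of e] mult_le_mono2[OF wl_u, of "nat \<bar>e\<bar>"]
    by linarith
  have wl_pow_x: "?wl (?pow x e) \<le> nat \<bar>e\<bar>" for e
    using Z_wr_Z.word_length_int_pow_le[OF S x(1), of e] mult_le_mono2[OF x(2), of "nat \<bar>e\<bar>"]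
    by linarith
  \<comment> \<open>For \<open>e \<ge> 1\<close> the last two factors merge: \<open>u\<^sup>e x = u\<^bsup>e - 1\<^esup> y\<close>.\<close>
  have wl_ux: "?wl (?pow u e \<cdot> x) \<le> nat \<bar>2 * e - 1\<bar>" for e
  proof (cases "e \<ge> 1")
    case True
    have "?pow u e = ?pow u (e - 1) \<cdot> u"
      using Z_wr_Z.int_pow_mult[OF u, of "e - 1" 1] u by (simp add: Z_wr_Z.int_pow_1)
    then have "?pow u e \<cdot> x = ?pow u (e - 1) \<cdot> y"
      using u x(1) by (simp add: Z_wr_Z.m_assoc ux)
    then show ?thesis
      using mult_le[OF Z_wr_Z.int_pow_closed[OF u] y(1), of "e - 1"] wl_pow_u[of "e - 1"] y(2) True
      by simp
  next
    case False
    then show ?thesis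
      using mult_le[OF Z_wr_Z.int_pow_closed[OF u] x(1), of e] wl_pow_u[of e] x(2) by simp
  qed
  show ?thesis
  proof (cases "snd x = snd y")
    case True
    show ?thesis
    proof (rule Z_wr_Z.growth_rate_ge_silver[OF S, where b = "\<lambda>e. ?pow u e \<cdot> x"])
      show "?pow u e \<cdot> x \<in> carrier Z_wr_Z" for e using u x by simp
      have "u \<noteq> \<one>\<^bsub>Z_wr_Z\<^esub>" using ux x(1) nc by auto
      moreover have "snd u = 0" using True x(1) by (simp add: u_def snd_wr_inv)
      ultimately show "L = L'" if "length L = length L'"
        "Z_wr_Z.block_product (\<lambda>e. ?pow u e \<cdot> x) L = Z_wr_Z.block_product (\<lambda>e. ?pow u e \<cdot> x) L'"
        for L L' using base_block_products_distinct[OF u x(1) _ _ pos that] by blast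
    qed (use wl_ux in blast)
  next
    case False
    have snd_u: "snd u = snd y - snd x" using x(1) by (simp add: u_def snd_wr_inv)
    have nc_u: "u \<cdot> x \<noteq> x \<cdot> u"
    proof
      assume "u \<cdot> x = x \<cdot> u"
      then have "y \<cdot> x = x \<cdot> y \<cdot> ?inv x \<cdot> x"
        unfolding ux using x y by (simp add: u_def Z_wr_Z.m_assoc)
      then show False using nc x y by (simp add: Z_wr_Z.m_assoc)
    qed
    show ?thesis
    proof (cases "2 * snd x \<le> snd y")
      case True
      show ?thesis
      proof (rule Z_wr_Z.growth_rate_ge_silver[OF S, where b = "wr_block x y 2"])
        have "?wl (wr_block x y 2 e) \<le> nat \<bar>e\<bar> + 1" for e
        proof (cases "- 2 \<le> e")
          case True
          then show ?thesis
            using mult_le[OF Z_wr_Z.int_pow_closed[OF x(1)] y(1), of e] wl_pow_x[of e] y(2)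
            by (simp add: wr_block_def)
        next
          case False
          have "?wl (x \<cdot> ?inv y) \<le> 2"
            using mult_le[OF x(1) Z_wr_Z.inv_closed[OF y(1)]] wl_inv x(2) by linarith
          moreover have "?wl (?pow x (- e - 2) \<cdot> y) \<le> nat \<bar>- e - 2\<bar> + 1"
            using mult_le[OF Z_wr_Z.int_pow_closed[OF x(1)] y(1), of "- e - 2"]
              wl_pow_x[of "- e - 2"] y(2) by linarith
          ultimately show ?thesis
            using mult_le[of "x \<cdot> ?inv y" "?pow x (- e - 2) \<cdot> y"] x y False
            by (simp add: wr_block_def)
        qed
        then show "(\<forall>e. ?wl (wr_block x y 2 e) \<le> nat \<bar>e\<bar> + 1) \<or>
            (\<forall>e. ?wl (wr_block x y 2 e) \<le> nat \<bar>2 * e - 1\<bar>)" by blast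
      qed (use wr_block_closed[OF x(1) y(1)]
        wr_block_products_distinct[OF x(1) y(1) nc pos True] in blast)+
    next
      case close: False
      have pos_u: "0 < snd u" and K: "1 * snd u \<le> snd x" using False close le snd_u by auto
      show ?thesis
      proof (rule Z_wr_Z.growth_rate_ge_silver[OF S, where b = "wr_block u x 1"])
        have "?wl (wr_block u x 1 e) \<le> nat \<bar>2 * e - 1\<bar>" for e
        proof (cases "- 1 \<le> e")
          case True
          then show ?thesis using wl_ux[of e] by (simp add: wr_block_def)
        next
          case False
          have "?wl (u \<cdot> ?inv x) \<le> 3"
            using mult_le[OF u Z_wr_Z.inv_closed[OF x(1)]] wl_inv wl_u by linarith
          then show ?thesis
            using mult_le[of "u \<cdot> ?inv x" "?pow u (- e - 1) \<cdot> x"] wl_ux[of "- e - 1"] u x False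
            by (simp add: wr_block_def)
        qed
        then show "(\<forall>e. ?wl (wr_block u x 1 e) \<le> nat \<bar>e\<bar> + 1) \<or>
            (\<forall>e. ?wl (wr_block u x 1 e) \<le> nat \<bar>2 * e - 1\<bar>)" by blast
      qed (use wr_block_closed[OF u x(1)]
        wr_block_products_distinct[OF u x(1) nc_u pos_u K] in blast)+
    qed
  qed
qed

text \<open>A generator with \<open>snd\<close> zero is either trivial or provides the first kind of blocks.\<close>

lemma growth_rate_ge_one_plus_sqrt2:
  assumes S: "finite_generating_set Z_wr_Z S"
  shows "1 + sqrt 2 \<le> growth_rate Z_wr_Z S"
proof -
  let ?wl = "word_length Z_wr_Z S"
  have sub: "S \<subseteq> carrier Z_wr_Z" and gen: "generate Z_wr_Z S = carrier Z_wr_Z"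
    using S by (auto simp: finite_generating_set_def)
  have wl: "?wl s \<le> 1" "?wl (inv\<^bsub>Z_wr_Z\<^esub> s) \<le> 1" if "s \<in> S" for s
    using Z_wr_Z.word_length_generator_le[OF S that] Z_wr_Z.word_length_inv_le[OF S, of s] sub that
    by fastforce+
  have positive: "\<exists>x' \<in> {x, inv\<^bsub>Z_wr_Z\<^esub> x}. 0 < snd x'" if "x \<in> S" "snd x \<noteq> 0" for x
    using snd_wr_inv[of x] sub that by (cases "0 < snd x") auto
  show ?thesis
  proof (cases "\<exists>s\<in>S. snd s = 0 \<and> s \<noteq> \<one>\<^bsub>Z_wr_Z\<^esub>")
    case True
    then obtain s where s: "s \<in> S" "snd s = 0" "s \<noteq> \<one>\<^bsub>Z_wr_Z\<^esub>" by blast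
    obtain x where x: "x \<in> S" "snd x \<noteq> 0" using exists_generator_snd_nonzero[OF sub gen] .
    obtain x' where x': "x' \<in> {x, inv\<^bsub>Z_wr_Z\<^esub> x}" "0 < snd x'" using positive[OF x] by blast
    show ?thesis
      using growth_rate_ge_of_base_generator[OF S _ wl(1)[OF s(1)] s(2,3), of x'] s(1) x x' sub
        wl[OF x(1)] by auto
  next
    case False
    obtain x y where xy: "x \<in> S" "y \<in> S" "x \<cdot> y \<noteq> y \<cdot> x"
      using exists_noncommuting_generators[OF sub gen] .
    have car: "x \<in> carrier Z_wr_Z" "y \<in> carrier Z_wr_Z" using xy sub by auto
    have "snd x \<noteq> 0" "snd y \<noteq> 0" using False xy car by auto
    then obtain x' y' where x': "x' \<in> {x, inv\<^bsub>Z_wr_Z\<^esub> x}" "0 < snd x'"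
      and y': "y' \<in> {y, inv\<^bsub>Z_wr_Z\<^esub> y}" "0 < snd y'"
      using positive xy by meson
    have cx: "x' \<in> carrier Z_wr_Z" "?wl x' \<le> 1" and cy: "y' \<in> carrier Z_wr_Z" "?wl y' \<le> 1"
      using x'(1) y'(1) car wl[OF xy(1)] wl[OF xy(2)] by auto
    have swap: "h \<cdot> g = g \<cdot> h" if "h' \<cdot> g = g \<cdot> h'" "h' \<in> {h, inv\<^bsub>Z_wr_Z\<^esub> h}"
      "h \<in> carrier Z_wr_Z" "g \<in> carrier Z_wr_Z" for g h h'
      using that Z_wr_Z.commute_inv[of "inv\<^bsub>Z_wr_Z\<^esub> h" g] by auto
    have nc: "x' \<cdot> y' \<noteq> y' \<cdot> x'"
      using swap[OF _ x'(1) car(1) cy(1)] swap[OF _ y'(1) car(2) car(1)] xy(3) by metis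
    show ?thesis
      using growth_rate_ge_of_noncommuting[OF S cx cy nc x'(2)]
        growth_rate_ge_of_noncommuting[OF S cy cx nc[symmetric] y'(2)] by linarith
  qed
qed

section \<open>The growth rate of the standard generators\<close>

text \<open>The \<open>\<ell>\<^sup>1\<close> norm of a finitely supported lamp configuration.\<close>

definition height_sum :: "(int \<Rightarrow> int) \<Rightarrow> int" where
  "height_sum f = (\<Sum>i | f i \<noteq> 0. \<bar>f i\<bar>)"

lemma height_sum_eq:
  assumes "finite I" "\<And>i. i \<notin> I \<Longrightarrow> f i = 0"
  shows "height_sum f = (\<Sum>i\<in>I. \<bar>f i\<bar>)"
  unfolding height_sum_def using assms by (intro sum.mono_neutral_left) auto

text \<open>
  Here \<open>{l..r}\<close> is the range of the walk of the lamplighter. Covering it on the way from \<open>0\<close> to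
  \<open>snd (wv w)\<close> takes at least \<open>2 (r - l) - |snd (wv w)|\<close> letters \<open>t\<close> or \<open>t\<^sup>-\<^sup>1\<close>.
\<close>

lemma at_word_tour:
  assumes "w \<in> lists ({gen_a, gen_t} \<times> UNIV)"
  shows "\<exists>l r. l \<le> 0 \<and> l \<le> snd (wv w) \<and> 0 \<le> r \<and> snd (wv w) \<le> r \<and>
    (\<forall>i. i \<notin> {l..r} \<longrightarrow> fst (wv w) i = 0) \<and>
    height_sum (fst (wv w)) + 2 * (r - l) - \<bar>snd (wv w)\<bar> \<le> int (length w)"
  using assms
proof (induction w rule: rev_induct)
  case Nil
  show ?case by (intro exI[of _ 0]) (simp add: wv_Nil height_sum_def)
next
  case (snoc p w)
  obtain x b where p: "p = (x, b)" by (cases p)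
  have w: "w \<in> lists ({gen_a, gen_t} \<times> UNIV)" and x: "x = gen_a \<or> x = gen_t"
    using snoc.prems p by auto
  obtain l r where IH: "l \<le> 0" "l \<le> snd (wv w)" "0 \<le> r" "snd (wv w) \<le> r"
    "\<And>i. i \<notin> {l..r} \<Longrightarrow> fst (wv w) i = 0"
    "height_sum (fst (wv w)) + 2 * (r - l) - \<bar>snd (wv w)\<bar> \<le> int (length w)"
    using snoc.IH[OF w] by blast
  have "wv (w @ [p]) = wv w \<cdot> wv [p]" using wv_append[OF w, of "[p]"] snoc.prems by simp
  moreover have "wv [p] = (if b then x else inv\<^bsub>Z_wr_Z\<^esub> x)"
    using x gens_in_carrier by (auto simp: p word_value_def)
  ultimately have wp: "wv (w @ [p]) = wv w \<cdot> (if b then x else inv\<^bsub>Z_wr_Z\<^esub> x)" by simp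
  show ?case
  proof (cases "x = gen_a")
    case True
    define c :: int where "c = (if b then 1 else - 1)"
    have snd: "snd (wv (w @ [p])) = snd (wv w)"
      using True by (simp add: wp inv_gen_a) (simp add: gen_a_def)
    have fst: "fst (wv (w @ [p])) = (\<lambda>i. fst (wv w) i + (if i = snd (wv w) then c else 0))"
      using True by (auto simp: wp inv_gen_a c_def fun_eq_iff) (auto simp: gen_a_def)
    have out: "fst (wv (w @ [p])) i = 0" if "i \<notin> {l..r}" for i
      using IH that by (auto simp: fst)
    have "height_sum (fst (wv (w @ [p]))) = (\<Sum>i\<in>{l..r}. \<bar>fst (wv (w @ [p])) i\<bar>)"
      using out by (intro height_sum_eq) auto
    also have "\<dots> \<le> (\<Sum>i\<in>{l..r}. \<bar>fst (wv w) i\<bar> + (if i = snd (wv w) then 1 else 0))"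
      by (intro sum_mono) (auto simp: fst c_def)
    also have "\<dots> = height_sum (fst (wv w)) + 1"
      using IH(2,4) height_sum_eq[of "{l..r}", OF _ IH(5)] by (simp add: sum.distrib)
    finally have "height_sum (fst (wv (w @ [p]))) \<le> height_sum (fst (wv w)) + 1" .
    then show ?thesis
      using IH out unfolding snd by (intro exI[of _ l] exI[of _ r]) auto
  next
    case False
    define c :: int where "c = (if b then 1 else - 1)"
    have snd: "snd (wv (w @ [p])) = snd (wv w) + c"
      using False x by (auto simp: wp inv_gen_t c_def) (auto simp: gen_t_def)
    have fst: "fst (wv (w @ [p])) = fst (wv w)"
      using False x by (auto simp: wp inv_gen_t fun_eq_iff) (auto simp: gen_t_def)
    define m where "m = snd (wv w)"
    have "c = 1 \<or> c = - 1" by (simp add: c_def)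
    then have "height_sum (fst (wv w)) + 2 * (max r (m + c) - min l (m + c)) - \<bar>m + c\<bar> \<le>
        int (length (w @ [p]))"
      using IH(1-4,6) unfolding m_def[symmetric] by (auto simp: min_def max_def abs_if split: if_splits)
    then show ?thesis
      unfolding snd fst m_def[symmetric] using IH(1,3)
      by (intro exI[of _ "min l (m + c)"] exI[of _ "max r (m + c)"] conjI allI impI IH(5)) auto
  qed
qed

lemma sum_int_interval_silver_le:
  "(\<Sum>v\<in>{- int k..int k}. (sqrt 2 - 1 :: real) ^ nat \<bar>v\<bar>) \<le> 1 + sqrt 2"
proof -
  let ?z = "sqrt 2 - 1 :: real"
  let ?E = "(\<lambda>j. 0 + int j) ` {..<Suc k} \<union> (\<lambda>j. 0 - 1 - int j) ` {..<Suc k}"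
  have z: "0 < ?z" "?z < 1" using sqrt2_less_2 by auto
  have "v \<in> ?E" if "v \<in> {- int k..int k}" for v
    using that by (cases v rule: int_cases) (auto simp: image_iff intro!: bexI[of _ "nat (- v - 1)"])
  then have "{- int k..int k} \<subseteq> ?E" by blast
  then have "(\<Sum>v\<in>{- int k..int k}. ?z ^ nat \<bar>v\<bar>) \<le> (\<Sum>v\<in>?E. ?z ^ nat \<bar>v\<bar>)"
    using z by (intro sum_mono2) auto
  also have "\<dots> = (\<Sum>j<Suc k. ?z ^ nat \<bar>0 + int j\<bar> + ?z ^ nat \<bar>0 - 1 - int j\<bar>)"
    by (rule sum_int_halves(1))
  also have "\<dots> = (\<Sum>j<Suc k. (1 + ?z) * ?z ^ j)"
  proof (rule sum.cong[OF refl])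
    fix j
    have "nat \<bar>0 + int j\<bar> = j" "nat \<bar>0 - 1 - int j\<bar> = Suc j" by auto
    then show "?z ^ nat \<bar>0 + int j\<bar> + ?z ^ nat \<bar>0 - 1 - int j\<bar> = (1 + ?z) * ?z ^ j"
      by (simp only:) (simp add: algebra_simps)
  qed
  also have "\<dots> = (1 + ?z) * (\<Sum>j<Suc k. ?z ^ j)" by (simp only: sum_distrib_left)
  also have "\<dots> \<le> (1 + ?z) * (1 / (1 - ?z))"
    using geometric_sum_less[OF z, of "{..<Suc k}"] z by (intro mult_left_mono) auto
  also have "\<dots> = 1 + sqrt 2"
    using z by (simp add: field_simps)
  finally show ?thesis .
qed

text \<open>
  Each configuration counted has weight at least \<open>z\<^sup>k\<close>, where \<open>z = \<surd>2 - 1\<close>, and the total weight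
  factors over the sites in \<open>I\<close>.
\<close>

lemma card_bounded_height_le:
  fixes I :: "int set" and k :: nat
  defines "A \<equiv> {f :: int \<Rightarrow> int. (\<forall>i. i \<notin> I \<longrightarrow> f i = 0) \<and> height_sum f \<le> int k}"
  assumes I: "finite I"
  shows "finite A" "real (card A) \<le> (1 + sqrt 2) ^ (card I + k)"
proof -
  let ?z = "sqrt 2 - 1 :: real"
  have z: "0 < ?z" "?z \<le> 1" using sqrt2_less_2 by auto
  let ?P = "PiE I (\<lambda>_. {- int k..int k})"
  define B where "B = {g \<in> ?P. (\<Sum>i\<in>I. nat \<bar>g i\<bar>) \<le> k}"
  have finP: "finite ?P" using I by (intro finite_PiE) auto
  have finB: "finite B" using finP by (simp add: B_def)
  have inj: "inj_on (\<lambda>f. restrict f I) A"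
  proof (rule inj_onI, rule ext)
    fix f g i assume "f \<in> A" "g \<in> A" "restrict f I = restrict g I"
    then show "f i = g i" by (cases "i \<in> I") (auto simp: A_def dest: fun_cong[of _ _ i])
  qed
  have sub: "(\<lambda>f. restrict f I) ` A \<subseteq> B"
  proof (rule image_subsetI)
    fix f assume f: "f \<in> A"
    then have "height_sum f = (\<Sum>i\<in>I. \<bar>f i\<bar>)" using I by (intro height_sum_eq) (auto simp: A_def)
    then have le: "(\<Sum>i\<in>I. \<bar>f i\<bar>) \<le> int k" using f by (simp add: A_def)
    have "- int k \<le> f i \<and> f i \<le> int k" if "i \<in> I" for i
    proof -
      have "\<bar>f i\<bar> \<le> (\<Sum>i\<in>I. \<bar>f i\<bar>)" using that I by (intro member_le_sum) auto
      then show ?thesis using le by linarith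
    qed
    then have "restrict f I \<in> ?P" by auto
    moreover have "int (\<Sum>i\<in>I. nat \<bar>f i\<bar>) \<le> int k" using le by simp
    then have "(\<Sum>i\<in>I. nat \<bar>f i\<bar>) \<le> k" by (simp only: of_nat_le_iff)
    ultimately show "restrict f I \<in> B" by (simp add: B_def)
  qed
  show "finite A" using inj_on_finite[OF inj sub finB] .
  have "card A \<le> card B" using card_inj_on_le[OF inj sub finB] .
  then have "real (card A) * ?z ^ k \<le> real (card B) * ?z ^ k" using z by (simp add: mult_right_mono)
  also have "\<dots> = (\<Sum>g\<in>B. ?z ^ k)" by simp
  also have "\<dots> \<le> (\<Sum>g\<in>B. \<Prod>i\<in>I. ?z ^ nat \<bar>g i\<bar>)"
  proof (rule sum_mono)
    fix g assume "g \<in> B"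
    then have "?z ^ k \<le> ?z ^ (\<Sum>i\<in>I. nat \<bar>g i\<bar>)" using z by (intro power_decreasing) (auto simp: B_def)
    then show "?z ^ k \<le> (\<Prod>i\<in>I. ?z ^ nat \<bar>g i\<bar>)" by (simp add: power_sum)
  qed
  also have "\<dots> \<le> (\<Sum>g\<in>?P. \<Prod>i\<in>I. ?z ^ nat \<bar>g i\<bar>)"
    using z finP by (intro sum_mono2 prod_nonneg) (auto simp: B_def)
  also have "\<dots> = (\<Prod>i\<in>I. \<Sum>v\<in>{- int k..int k}. ?z ^ nat \<bar>v\<bar>)"
    using I by (intro prod_sum_PiE[symmetric]) auto
  also have "\<dots> \<le> (\<Prod>i\<in>I. 1 + sqrt 2)"
    using sum_int_interval_silver_le z by (intro prod_mono) (auto intro!: sum_nonneg)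
  also have "\<dots> = (1 + sqrt 2) ^ card I" by simp
  finally have "real (card A) * ?z ^ k \<le> (1 + sqrt 2) ^ card I" .
  moreover have "?z ^ k * (1 + sqrt 2) ^ k = 1"
    by (simp add: power_mult_distrib[symmetric] algebra_simps)
  ultimately have "real (card A) * ?z ^ k * (1 + sqrt 2) ^ k \<le> (1 + sqrt 2) ^ card I * (1 + sqrt 2) ^ k"
    by (intro mult_right_mono) auto
  then show "real (card A) \<le> (1 + sqrt 2) ^ (card I + k)"
    using \<open>?z ^ k * (1 + sqrt 2) ^ k = 1\<close> by (simp add: power_add mult.assoc)
qed

text \<open>
  The polynomial factor counts the choices of \<open>(l, r, m)\<close>. For each of them the exponent
  \<open>(r - l + 1) + (n - 2 (r - l) + |m|)\<close> is at most \<open>n + 1\<close> because \<open>|m| \<le> r - l\<close>.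
\<close>

lemma growth_function_standard_le:
  "real (growth_function Z_wr_Z {gen_a, gen_t} n) \<le>
    real ((n + 1)\<^sup>2 * (2 * n + 1)) * (1 + sqrt 2) ^ (n + 1)"
proof -
  define P where "P = {(l, r, m). l \<in> {- int n..0} \<and> r \<in> {0..int n} \<and> m \<in> {- int n..int n} \<and>
    \<bar>m\<bar> \<le> r - l \<and> 2 * (r - l) - \<bar>m\<bar> \<le> int n}"
  define A where "A = (\<lambda>(l, r, m). {f :: int \<Rightarrow> int. (\<forall>i. i \<notin> {l..r} \<longrightarrow> f i = 0) \<and>
    height_sum f \<le> int (nat (int n - 2 * (r - l) + \<bar>m\<bar>))})"
  let ?C = "{- int n..0} \<times> {0..int n} \<times> {- int n..int n}"
  let ?B = "{g \<in> carrier Z_wr_Z. word_length Z_wr_Z {gen_a, gen_t} g \<le> n}"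
  have finP: "finite P" and cardP: "card P \<le> (n + 1)\<^sup>2 * (2 * n + 1)"
  proof -
    have sub: "P \<subseteq> ?C" by (auto simp: P_def)
    then show "finite P" by (rule finite_subset) auto
    have "card P \<le> card ?C" by (rule card_mono[OF _ sub]) auto
    also have "card ?C = nat (int n + 1) * (nat (int n + 1) * nat (int n + int n + 1))"
      by (simp add: card_cartesian_product)
    also have "\<dots> = (n + 1) * ((n + 1) * (2 * n + 1))"
    proof -
      have "nat (int n + 1) = n + 1" "nat (int n + int n + 1) = 2 * n + 1" by auto
      then show ?thesis by (simp only:)
    qed
    also have "\<dots> = (n + 1)\<^sup>2 * (2 * n + 1)" by (simp only: power2_eq_square mult.assoc)
    finally show "card P \<le> (n + 1)\<^sup>2 * (2 * n + 1)" .
  qed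
  have finA: "finite (A q)" for q
    unfolding A_def by (cases q) (simp only: prod.case, rule card_bounded_height_le(1), simp)
  have cardA: "real (card (A q)) \<le> (1 + sqrt 2) ^ (n + 1)" if q: "q \<in> P" for q
  proof -
    obtain l r m where q_eq: "q = (l, r, m)" by (metis surj_pair)
    let ?k = "nat (int n - 2 * (r - l) + \<bar>m\<bar>)"
    have "real (card (A q)) \<le> (1 + sqrt 2) ^ (card {l..r} + ?k)"
      using card_bounded_height_le(2)[of "{l..r}" ?k] by (simp add: A_def q_eq)
    also have "\<dots> \<le> (1 + sqrt 2) ^ (n + 1)"
      using q by (intro power_increasing) (auto simp: P_def q_eq)
    finally show ?thesis .
  qed
  have "?B \<subseteq> (\<Union>q\<in>P. (\<lambda>f. (f, snd (snd q))) ` A q)"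
  proof
    fix g assume "g \<in> ?B"
    then obtain w where w: "w \<in> lists ({gen_a, gen_t} \<times> UNIV)" "length w \<le> n" "g = wv w"
      unfolding Z_wr_Z.growth_ball_eq[OF finite_generating_set_gens] by blast
    obtain l r where lr: "l \<le> 0" "l \<le> snd g" "0 \<le> r" "snd g \<le> r"
      "\<And>i. i \<notin> {l..r} \<Longrightarrow> fst g i = 0"
      "height_sum (fst g) + 2 * (r - l) - \<bar>snd g\<bar> \<le> int (length w)"
      using at_word_tour[OF w(1)] unfolding w(3) by blast
    have nonneg: "0 \<le> height_sum (fst g)" by (simp add: height_sum_def sum_nonneg)
    then have "(l, r, snd g) \<in> P" using lr w(2) by (auto simp: P_def)
    moreover have "fst g \<in> A (l, r, snd g)" using lr w(2) nonneg by (auto simp: A_def)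
    ultimately show "g \<in> (\<Union>q\<in>P. (\<lambda>f. (f, snd (snd q))) ` A q)"
      by (intro UN_I[of "(l, r, snd g)"] image_eqI[of _ _ "fst g"]) auto
  qed
  then have "card ?B \<le> card (\<Union>q\<in>P. (\<lambda>f. (f, snd (snd q))) ` A q)"
    using finP finA by (intro card_mono) auto
  also have "\<dots> \<le> (\<Sum>q\<in>P. card ((\<lambda>f. (f, snd (snd q))) ` A q))"
    using finP by (rule card_UN_le)
  also have "\<dots> \<le> (\<Sum>q\<in>P. card (A q))" using finA by (intro sum_mono card_image_le) auto
  finally have "real (card ?B) \<le> (\<Sum>q\<in>P. real (card (A q)))"
    by (simp only: of_nat_sum[symmetric] of_nat_le_iff)
  also have "\<dots> \<le> real (card P) * (1 + sqrt 2) ^ (n + 1)"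
    using cardA by (rule sum_bounded_above)
  also have "\<dots> \<le> real ((n + 1)\<^sup>2 * (2 * n + 1)) * (1 + sqrt 2) ^ (n + 1)"
    using cardP by (intro mult_right_mono) (simp_all only: of_nat_le_iff, simp)
  finally show ?thesis by (simp add: growth_function_def)
qed

lemma growth_rate_standard_le: "growth_rate Z_wr_Z {gen_a, gen_t} \<le> 1 + sqrt 2"
proof -
  let ?F = "\<lambda>n. real (growth_function Z_wr_Z {gen_a, gen_t} n)"
  let ?c = "12 * (1 + sqrt 2) :: real"
  have "(\<lambda>n. root n ?c * root n (real n) ^ 3 * (1 + sqrt 2)) \<longlonglongrightarrow> 1 * 1 ^ 3 * (1 + sqrt 2)"
    by (intro tendsto_intros LIMSEQ_root LIMSEQ_root_const) (simp add: add_pos_pos)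
  moreover have "eventually (\<lambda>n. root n (?F n) \<le> root n ?c * root n (real n) ^ 3 * (1 + sqrt 2)) sequentially"
    using eventually_gt_at_top[of 0]
  proof eventually_elim
    case (elim n)
    have "real ((n + 1)\<^sup>2 * (2 * n + 1)) \<le> real ((2 * n)\<^sup>2 * (3 * n))"
      unfolding of_nat_le_iff using elim by (intro mult_mono power_mono) auto
    also have "\<dots> = 12 * real n ^ 3" by (simp add: power2_eq_square power3_eq_cube)
    finally have "?F n \<le> (12 * real n ^ 3) * (1 + sqrt 2) ^ (n + 1)"
      using growth_function_standard_le[of n]
      by (meson mult_right_mono order.trans zero_le_power add_nonneg_nonneg real_sqrt_ge_zero
          zero_le_numeral zero_le_one)
    also have "\<dots> = ?c * real n ^ 3 * (1 + sqrt 2) ^ n" by simp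
    finally have "root n (?F n) \<le> root n (?c * real n ^ 3 * (1 + sqrt 2) ^ n)"
      using elim by simp
    also have "\<dots> = root n ?c * root n (real n) ^ 3 * (1 + sqrt 2)"
      using elim by (simp add: real_root_mult real_root_power real_root_power_cancel)
    finally show ?case .
  qed
  ultimately show ?thesis
    using tendsto_le[OF _ _ Z_wr_Z.growth_rate_tendsto[OF finite_generating_set_gens]] by simp
qed

theorem corollary3:
  shows "has_presentation Z_wr_Z {gen_a, gen_t} {Z_wr_Z_relator k | k. k \<ge> 1} \<and>
    finite_generating_set Z_wr_Z {gen_a, gen_t} \<and>
    minimal_growth_rate Z_wr_Z = growth_rate Z_wr_Z {gen_a, gen_t} \<and>
    growth_rate Z_wr_Z {gen_a, gen_t} = 1 + sqrt 2"
proof -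
  have rate: "growth_rate Z_wr_Z {gen_a, gen_t} = 1 + sqrt 2"
    using growth_rate_standard_le growth_rate_ge_one_plus_sqrt2[OF finite_generating_set_gens]
    by (rule antisym)
  have "minimal_growth_rate Z_wr_Z = growth_rate Z_wr_Z {gen_a, gen_t}"
    unfolding minimal_growth_rate_def
  proof (rule cInf_eq_minimum)
    show "growth_rate Z_wr_Z {gen_a, gen_t} \<in> growth_rate Z_wr_Z ` {S. finite_generating_set Z_wr_Z S}"
      using finite_generating_set_gens by simp
  qed (use growth_rate_ge_one_plus_sqrt2 rate in auto)
  with rate show ?thesis
    using presentation_Z_wr_Z finite_generating_set_gens by blast
qed

end
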